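(* For every integer $n>0$, the $n$-dimensional volume (hypersurface measure) of the unit sphere $S^n\subset\mathbb{R}^{n+1}$ is $$\mathrm{vol}(S^{n})=2\cdot Z(0)\cdot Z(-1)\cdots Z(-n+1)=2\prod_{j=0}^{n-1}Z(-j),$$ where $Z(s)=\pi\,2^{s}\,\zeta_{\mathbb{Z}}(s/2)$ and $\zeta_{\mathbb{Z}}$ is the spectral zeta function of $\mathbb{Z}$.
   Context: The spectral zeta function of $\mathbb{Z}$ is defined by $$\zeta_{\mathbb{Z}}(s)=\frac{1}{\Gamma(s)}\int_{0}^{\infty}e^{-2t}I_{0}(2t)\,t^{s}\,\frac{dt}{t}\qquad\text{for }0<\mathrm{Re}(s)<1/2,$$ where $I_0$ is the modified Bessel function of the first kind of order $0$, and is extended to $\mathbb{C}$ by meromorphic continuation. It is known (from earlier work) that this meromorphic continuation is given by $$\zeta_{\mathbb{Z}}(s)=\frac{1}{4^{s}\sqrt{\pi}}\frac{\Gamma(1/2-s)}{\Gamma(1-s)}=\frac{\Gamma(1-2s)}{\Gamma(1-s)^2}.$$ *)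

theory Defs
  imports "HOL-Complex_Analysis.Complex_Analysis"
begin

definition bessel_I :: "nat \<Rightarrow> real \<Rightarrow> real" where
  "bessel_I n x = (\<Sum>k. (x / 2) ^ (2 * k + n) / (fact k * fact (k + n)))"

definition zeta_Z_integral :: "complex \<Rightarrow> complex" where
  "zeta_Z_integral s = 1 / Gamma s *
     (LINT t:{0<..}|lborel.
        of_real (exp (- 2 * t) * bessel_I 0 (2 * t)) * of_real t powr s / of_real t)"

(* "Nicely" meromorphic functions are analytic away from their poles and take the value 0
   at each pole, so the continuation is unique as a total function. *)
definition zeta_Z :: "complex \<Rightarrow> complex" where
  "zeta_Z = (THE f. f nicely_meromorphic_on UNIV \<and>
     (\<forall>s. 0 < Re s \<and> Re s < 1 / 2 \<longrightarrow> f s = zeta_Z_integral s))"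

definition Z_fun :: "complex \<Rightarrow> complex" where
  "Z_fun s = of_real pi * 2 powr s * zeta_Z (s / 2)"

definition local_parametrization ::
    "(real ^ 'm) set \<Rightarrow> (real ^ 'n) set \<Rightarrow> (real ^ 'n \<Rightarrow> real ^ 'm) \<Rightarrow> bool" where
  "local_parametrization M U \<phi> \<longleftrightarrow>
     open U \<and> openin (top_of_set M) (\<phi> ` U) \<and>
     (\<exists>\<psi>. homeomorphism U (\<phi> ` U) \<phi> \<psi>) \<and>
     (\<forall>x\<in>U. \<phi> differentiable (at x)) \<and>
     continuous_on U (\<lambda>x. matrix (frechet_derivative \<phi> (at x))) \<and>
     (\<forall>x\<in>U. inj (frechet_derivative \<phi> (at x)))"

definition gram_density :: "(real ^ 'n \<Rightarrow> real ^ 'm) \<Rightarrow> real ^ 'n \<Rightarrow> real" where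
  "gram_density \<phi> x =
     (let J = matrix (frechet_derivative \<phi> (at x)) in sqrt (det (transpose J ** J)))"

(* The Riemannian volume measure of an embedded C^1 submanifold M of R^m, where m = CARD('m)
   and dim M = CARD('n): the unique Borel measure on M that is given in every local
   parametrization by the density sqrt (det g), with g the metric induced by the Euclidean
   one.  It is the hypersurface measure of M when m = CARD('n) + 1.  For other sets M the
   definite description need not denote. *)
definition volume_measure ::
    "'n::finite itself \<Rightarrow> (real ^ 'm::finite) set \<Rightarrow> (real ^ 'm) measure" where
  "volume_measure _ M = (THE \<sigma>. sets \<sigma> = sets (restrict_space borel M) \<and>
     (\<forall>(U :: (real ^ 'n) set) \<phi>. local_parametrization M U \<phi> \<longrightarrow>
        (\<forall>B\<in>sets borel. B \<subseteq> U \<longrightarrow>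
           emeasure \<sigma> (\<phi> ` B) = (\<integral>\<^sup>+x\<in>B. ennreal (gram_density \<phi> x) \<partial>lborel))))"

end

(*
  Put w(v) = 1 / (1 + v^2).  The powers of 2 w - 1 are integrated against w(v) dv by a recursion that
  comes from differentiating (2 w - 1)^(n+1) v w, which gives
  pi e^(-2t) I_0(2t) = int e^(-4 t w(v)) w(v) dv.  Exchanging the integrals over t and v turns the
  integral defining zeta_Z into a multiple of int w(v)^(1 - s) dv, and this is evaluated by a second
  exchange, with the Gamma integral on one side and the Gaussian integral on the other.  The values
  Z(-j) are then quotients of Gamma values whose product telescopes.

  For the sphere, A |-> (n + 1) * (Lebesgue measure of the cone {r a | a in A, 0 < r <= 1}) has the
  density sqrt (det g) in every parametrization phi, by the change of variables (r, x) |-> r phi(x):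
  as phi is orthogonal to its partial derivatives, the Jacobian is r^n sqrt (det g).  Two
  stereographic charts cover the sphere and hence determine the measure.
*)
theory Submission
  imports Defs "HOL-Probability.Sinc_Integral" "HOL-Real_Asymp.Real_Asymp"
begin

text \<open>The weight w comes from v = tan(theta/2) in the classical formula pi I_0(x) = int_0^pi
  e^(x cos theta) dtheta: there cos theta = 2 w - 1, dtheta = 2 w dv and v w = (sin theta)/2, so the
  recursion is the Wallis reduction for powers of the cosine. Staying on the whole line pays off at
  the end, because 1/w = 1 + v^2 is a constant plus a Gaussian exponent. The strip 0 < Re s < 1/2
  reflects the two integrations: Re s > 0 is needed for the one over t, and Re s < 1/2 for that of
  w^(1 - s).

  Both \<open>zeta_Z\<close> and \<open>volume_measure\<close> are definite descriptions. For each
  of them a candidate must be shown to satisfy the description and to be the only one; for the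
  first, uniqueness includes the values at the poles.

  A parametrization maps R^n into R^(n+1), so its derivative is not square. The cone supplies the
  missing radial dimension, after which a change of variables in equal dimensions applies, and n + 1
  is the reciprocal of int_0^1 r^n dr.\<close>

no_notation fps_nth (infixl "$" 75)

section \<open>The spectral zeta function of the integers\<close>

subsection \<open>Meromorphic continuation\<close>

text \<open>The arguments of the two Gamma factors differ by 1/2, so they cannot both be integers.
  Hence no pole of the numerator of the closed form is cancelled by a zero of
  \<open>rGamma\<close>.\<close>

lemma rGamma_nonzero_at_half_pole: "1/2 - s \<in> \<int>\<^sub>\<le>\<^sub>0 \<Longrightarrow> rGamma (1 - s :: complex) \<noteq> 0"
proof
  assume "1/2 - s \<in> \<int>\<^sub>\<le>\<^sub>0" "rGamma (1 - s) = 0"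
  then obtain m n :: int where mn: "1/2 - s = of_int m" "1 - s = of_int n"
    by (auto simp: rGamma_eq_zero_iff elim!: nonpos_Ints_cases)
  have "of_int n - of_int m = (1/2 :: complex)"
  proof -
    have "(1 - s) - (1/2 - s) = (1/2 :: complex)" by simp
    thus ?thesis using \<open>1/2 - s = of_int m\<close> \<open>1 - s = of_int n\<close> by simp
  qed
  hence "of_int (2 * (n - m)) = (of_int 1 :: complex)"
    by (simp add: algebra_simps)
  hence "2 * (n - m) = 1" by (simp only: of_int_eq_iff)
  thus False by presburger
qed

text \<open>The known closed form, grouped as \<open>Gamma (1/2 - s)\<close> times an entire
  function, so that the first factor is the only source of poles.\<close>

definition zeta_Z_formula :: "complex \<Rightarrow> complex" where
  "zeta_Z_formula s = Gamma (1/2 - s) * (rGamma (1 - s) / (4 powr s * of_real (sqrt pi)))"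

lemma zeta_Z_formula_nicely_meromorphic: "zeta_Z_formula nicely_meromorphic_on UNIV"
proof (rule nicely_meromorphic_onI_open)
  let ?pts = "{s. 1/2 - s \<in> (\<int>\<^sub>\<le>\<^sub>0 :: complex set)}"
  have an: "zeta_Z_formula analytic_on {s}" if "s \<notin> ?pts" for s
    unfolding zeta_Z_formula_def
    by (intro analytic_intros) (use that in auto)
  show "zeta_Z_formula analytic_on UNIV - ?pts"
    by (subst analytic_on_analytic_at) (use an in auto)
  show "is_pole zeta_Z_formula s \<and> zeta_Z_formula s = 0" if "s \<in> ?pts" for s
  proof
    from that obtain n where n: "1/2 - s = -of_nat n" 
      by (auto elim!: nonpos_Ints_cases')
    have "filterlim (\<lambda>z. 1/2 - z) (at (1/2 - s)) (at s)"
      by (intro filterlim_atI tendsto_intros) (auto simp: eventually_at_filter)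
    hence "filterlim (\<lambda>z. Gamma (1/2 - z)) at_infinity (at s)"
      unfolding n by (rule filterlim_compose[OF Gamma_poles])
    hence "is_pole (\<lambda>z. Gamma (1/2 - z)) s" by (simp add: is_pole_def)
    moreover have "(\<lambda>s. rGamma (1 - s) / (4 powr s * of_real (sqrt pi))) analytic_on {s}"
      by (intro analytic_intros) auto
    moreover have "rGamma (1 - s) / (4 powr s * of_real (sqrt pi)) \<noteq> 0"
      using rGamma_nonzero_at_half_pole[of s] that by simp
    ultimately show "is_pole zeta_Z_formula s"
      unfolding zeta_Z_formula_def by (intro is_pole_mult_analytic_nonzero2)
    \<comment> \<open>\<open>Gamma\<close> has the value 0 at its poles by convention, and this is
      the value that nicely meromorphic functions take there.\<close>
    show "zeta_Z_formula s = 0"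
      using that by (simp add: zeta_Z_formula_def Gamma_eq_zero_iff)
  qed
  show "isolated_singularity_at zeta_Z_formula s" for s
  proof (cases "s \<in> ?pts")
    case True
    \<comment> \<open>Two candidate poles differ by an integer, so a ball of radius 1 around one of
      them contains no other.\<close>
    have "w \<notin> ?pts" if w: "w \<in> ball s 1 - {s}" for w
    proof
      assume "w \<in> ?pts"
      with True obtain m n where mn: "1/2 - s = of_int m" "1/2 - w = of_int n"
        by (auto elim!: nonpos_Ints_cases)
      have "w - s = (1/2 - s) - (1/2 - w)" by simp
      hence ws: "w - s = of_int (m - n)"
        unfolding mn by simp
      have "dist s w = norm (complex_of_int (m - n))"
        by (simp only: dist_norm norm_minus_commute[of s w] ws)
      hence "real_of_int \<bar>m - n\<bar> < 1"
        using w by (simp only: norm_of_int of_int_abs) simp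
      hence "m = n" by linarith
      thus False using ws w by simp
    qed
    hence "zeta_Z_formula analytic_on ball s 1 - {s}"
      using an by (subst analytic_on_analytic_at) auto
    thus ?thesis unfolding isolated_singularity_at_def by (intro exI[of _ 1]) simp
  qed (rule isolated_singularity_at_analytic, rule an)
qed simp

text \<open>By the identity theorem the difference, with its singularities removed, vanishes
  everywhere, so f and g agree on a punctured neighbourhood of every point. Such a neighbourhood
  determines the value at the point: it is the limit, or 0 at a pole.\<close>

lemma nicely_meromorphic_eqI:
  assumes f: "f nicely_meromorphic_on UNIV" and g: "g nicely_meromorphic_on UNIV"
    and S: "open S" "S \<noteq> {}" "\<And>z. z \<in> S \<Longrightarrow> f z = g z"
  shows "f = g"
proof
  fix z
  let ?h = "remove_sings (\<lambda>z. f z - g z)"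
  have mero: "(\<lambda>z. f z - g z) meromorphic_on UNIV"
    using f g by (intro meromorphic_intros) (auto simp: nicely_meromorphic_on_def)
  obtain a where a: "a \<in> S" using S by auto
  have h0: "?h w = 0" if "w \<in> S" for w
  proof (rule remove_sings_eqI)
    have "eventually (\<lambda>z. f z - g z = 0) (at w)"
      using eventually_at_in_open'[OF S(1) that] by eventually_elim (simp add: S)
    thus "(\<lambda>z. f z - g z) \<midarrow>w\<rightarrow> 0" by (rule tendsto_eventually)
  qed
  have "eventually (\<lambda>w. ?h w = 0) (at a)"
    using eventually_at_in_open'[OF S(1) a] by eventually_elim (simp add: h0)
  hence "frequently (\<lambda>w. ?h w = 0) (at a)"
    by (intro eventually_frequently) auto
  hence "?h w = 0" for w
    by (rule frequently_eq_meromorphic_imp_constant[OF _ remove_sings_nicely_meromorphic[OF mero]]) auto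
  moreover have "eventually (\<lambda>w. ?h w = f w - g w) (at z)"
    using eventually_remove_sings_eq[OF mero] by (rule eventually_cosparse_imp_eventually_at) auto
  ultimately have ev: "eventually (\<lambda>w. f w = g w) (at z)"
    by (auto elim: eventually_mono)
  have "is_pole f z \<longleftrightarrow> is_pole g z"
    by (rule is_pole_cong[OF ev refl])
  moreover have "f \<midarrow>z\<rightarrow> c \<longleftrightarrow> g \<midarrow>z\<rightarrow> c" for c
    by (rule tendsto_cong[OF ev])
  moreover have "is_pole f z \<and> f z = 0 \<or> f \<midarrow>z\<rightarrow> f z" "is_pole g z \<and> g z = 0 \<or> g \<midarrow>z\<rightarrow> g z"
    using f g by (auto simp: nicely_meromorphic_on_def)
  \<comment> \<open>A pole excludes a finite limit, so f and g are in the same one of the two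
    cases.\<close>
  moreover have "\<not> (is_pole f z \<and> f \<midarrow>z\<rightarrow> c)" for c
    unfolding is_pole_def using not_tendsto_and_filterlim_at_infinity[of "at z" f c] by auto
  ultimately show "f z = g z"
    using LIM_unique by metis
qed

subsection \<open>The Bessel function as an integral over the real line\<close>

lemma integral_FTC_real_line:
  fixes f F :: "real \<Rightarrow> real"
  assumes "\<And>x. (F has_real_derivative f x) (at x)" "\<And>x. isCont f x" "integrable lborel f"
    and "(F \<longlongrightarrow> A) at_bot" "(F \<longlongrightarrow> B) at_top"
  shows "(\<integral>x. f x \<partial>lborel) = B - A"
proof -
  have "(LBINT x=-\<infinity>..\<infinity>. f x) = B - A"
    using assms
    by (intro interval_integral_FTC_integrable)
       (auto simp: has_real_derivative_iff_has_vector_derivative set_integrable_def ereal_tendsto_simps)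
  thus ?thesis by (simp add: interval_lebesgue_integral_def set_lebesgue_integral_def)
qed

definition cauchy_weight :: "real \<Rightarrow> real" where
  "cauchy_weight v = inverse (1 + v\<^sup>2)"

lemma cauchy_weight_pos: "cauchy_weight v > 0"
  by (simp add: cauchy_weight_def add_pos_nonneg)

lemma cauchy_weight_le_1: "cauchy_weight v \<le> 1"
  by (simp add: cauchy_weight_def inverse_le_1_iff)

text \<open>Used to eliminate v^2, which turns the derivatives below into polynomials in the
  weight.\<close>

lemma cauchy_weight_eq: "v\<^sup>2 * cauchy_weight v = 1 - cauchy_weight v"
proof -
  have "1 + v\<^sup>2 \<noteq> 0" by (simp add: add_nonneg_eq_0_iff)
  thus ?thesis by (simp add: cauchy_weight_def field_simps)
qed

lemma has_derivative_cauchy_weight [derivative_intros]: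
  "(cauchy_weight has_real_derivative - (2 * v * (cauchy_weight v)\<^sup>2)) (at v)"
proof -
  have "1 + v\<^sup>2 \<noteq> 0" by (simp add: add_nonneg_eq_0_iff)
  thus ?thesis unfolding cauchy_weight_def
    by (auto intro!: derivative_eq_intros simp: field_simps power2_eq_square)
qed

lemma continuous_cauchy_weight: "continuous_on A cauchy_weight"
  using has_derivative_cauchy_weight DERIV_isCont continuous_at_imp_continuous_on by blast

lemma measurable_cauchy_weight [measurable]: "cauchy_weight \<in> borel_measurable borel"
  by (intro borel_measurable_continuous_onI continuous_cauchy_weight)

lemma integrable_cauchy_weight: "integrable lborel cauchy_weight"
  using integrable_inverse_1_plus_square
  by (simp add: set_integrable_def cauchy_weight_def[abs_def])

lemma integral_cauchy_weight: "(\<integral>v. cauchy_weight v \<partial>lborel) = pi"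
  using LBINT_inverse_1_plus_square
  by (simp add: interval_lebesgue_integral_def set_lebesgue_integral_def cauchy_weight_def)

lemma abs_two_cauchy_weight_minus_1: "\<bar>2 * cauchy_weight v - 1\<bar> \<le> 1"
  using cauchy_weight_pos[of v] cauchy_weight_le_1[of v] by linarith

lemma integrable_cauchy_moment:
  "integrable lborel (\<lambda>v. (2 * cauchy_weight v - 1) ^ n * cauchy_weight v)"
proof (rule Bochner_Integration.integrable_bound[OF integrable_cauchy_weight])
  show "AE v in lborel. norm ((2 * cauchy_weight v - 1) ^ n * cauchy_weight v) \<le> norm (cauchy_weight v)"
    using abs_two_cauchy_weight_minus_1
    by (intro AE_I2) (auto simp: abs_mult power_abs intro!: mult_left_le_one_le power_le_one)
qed simp

lemma tendsto_v_cauchy_weight: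
  "((\<lambda>v. v * cauchy_weight v) \<longlongrightarrow> 0) at_top" "((\<lambda>v. v * cauchy_weight v) \<longlongrightarrow> 0) at_bot"
  unfolding cauchy_weight_def by real_asymp+

lemma tendsto_moment_boundary:
  assumes "((\<lambda>v. v * cauchy_weight v) \<longlongrightarrow> 0) F"
  shows "((\<lambda>v. (2 * cauchy_weight v - 1) ^ n * (v * cauchy_weight v)) \<longlongrightarrow> 0) F"
proof (rule Lim_null_comparison)
  show "\<forall>\<^sub>F v in F. norm ((2 * cauchy_weight v - 1) ^ n * (v * cauchy_weight v)) \<le> \<bar>v * cauchy_weight v\<bar>"
    using abs_two_cauchy_weight_minus_1
    by (intro always_eventually allI) (auto simp: abs_mult power_abs intro!: mult_left_le_one_le power_le_one)
  show "((\<lambda>v. \<bar>v * cauchy_weight v\<bar>) \<longlongrightarrow> 0) F"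
    using tendsto_rabs[OF assms] by simp
qed

lemma has_derivative_v_cauchy_weight:
  "((\<lambda>v. v * cauchy_weight v) has_real_derivative (2 * cauchy_weight v - 1) * cauchy_weight v) (at v)"
proof -
  have "((\<lambda>v. v * cauchy_weight v) has_real_derivative cauchy_weight v - 2 * (v\<^sup>2 * cauchy_weight v) * cauchy_weight v) (at v)"
    by (auto intro!: derivative_eq_intros simp: power2_eq_square)
  thus ?thesis unfolding cauchy_weight_eq by (simp add: algebra_simps)
qed

lemma isCont_cauchy_weight: "isCont cauchy_weight v"
  using has_derivative_cauchy_weight by (rule DERIV_isCont)

lemma cauchy_moment_1: "(\<integral>v. (2 * cauchy_weight v - 1) * cauchy_weight v \<partial>lborel) = 0"
proof -
  have "isCont (\<lambda>v. (2 * cauchy_weight v - 1) * cauchy_weight v) v" for v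
    by (intro continuous_intros isCont_cauchy_weight)
  moreover have "integrable lborel (\<lambda>v. (2 * cauchy_weight v - 1) * cauchy_weight v)"
    using integrable_cauchy_moment[of 1] by simp
  ultimately show ?thesis
    using integral_FTC_real_line[OF has_derivative_v_cauchy_weight _ _ tendsto_v_cauchy_weight(2,1)]
    by simp
qed

lemma cauchy_moment_Suc_Suc:
  "real (n + 2) * (\<integral>v. (2 * cauchy_weight v - 1) ^ (n + 2) * cauchy_weight v \<partial>lborel) =
   real (n + 1) * (\<integral>v. (2 * cauchy_weight v - 1) ^ n * cauchy_weight v \<partial>lborel)"
proof -
  let ?w = cauchy_weight and ?c = "\<lambda>v. 2 * cauchy_weight v - 1"
  let ?f = "\<lambda>v. real (n + 2) * (?c v ^ (n + 2) * ?w v) - real (n + 1) * (?c v ^ n * ?w v)"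
  have deriv: "((\<lambda>v. ?c v ^ (n + 1) * (v * ?w v)) has_real_derivative ?f v) (at v)" for v
  proof -
    let ?p = "?c v ^ n"
    have "(?c has_real_derivative - (4 * v * (?w v)\<^sup>2)) (at v)"
      by (auto intro!: derivative_eq_intros)
    from DERIV_mult[OF DERIV_power[OF this, of "n + 1"] has_derivative_v_cauchy_weight]
    have "((\<lambda>v. ?c v ^ (n + 1) * (v * ?w v)) has_real_derivative
        ?p * (?c v * (?c v * ?w v) - 4 * real (n + 1) * (v\<^sup>2 * ?w v) * ?w v * ?w v)) (at v)"
      by (simp add: power2_eq_square algebra_simps del: of_nat_Suc of_nat_add)
    \<comment> \<open>After v^2 w = 1 - w, the remaining identity is 4 w (1 - w) = 1 - (2 w -
      1)^2.\<close>
    also have "?p * (?c v * (?c v * ?w v) - 4 * real (n + 1) * (v\<^sup>2 * ?w v) * ?w v * ?w v) =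
       ?p * (?c v * ?c v * ?w v - real (n + 1) * (1 - ?c v * ?c v) * ?w v)"
      unfolding cauchy_weight_eq by algebra
    also have "\<dots> = ?f v"
      by (simp add: algebra_simps)
    finally show ?thesis .
  qed
  have int: "integrable lborel ?f"
    by (intro Bochner_Integration.integrable_diff integrable_mult_right integrable_cauchy_moment)
  have "isCont ?f v" for v
    by (intro continuous_intros isCont_cauchy_weight)
  from integral_FTC_real_line[OF deriv this int tendsto_moment_boundary tendsto_moment_boundary, OF tendsto_v_cauchy_weight(2,1)]
  have "(\<integral>v. ?f v \<partial>lborel) = 0" by simp
  moreover have "(\<integral>v. ?f v \<partial>lborel) = real (n + 2) * (\<integral>v. ?c v ^ (n + 2) * ?w v \<partial>lborel) -
      real (n + 1) * (\<integral>v. ?c v ^ n * ?w v \<partial>lborel)"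
    by (subst Bochner_Integration.integral_diff)
       (simp_all only: integral_mult_right_zero integrable_mult_right integrable_cauchy_moment)
  ultimately show ?thesis by simp
qed

text \<open>The even moments are pi times the central binomial coefficient over 4^k. The recursion
  moves in steps of two, so one induction handles both parities.\<close>

lemma cauchy_moment:
  "(\<integral>v. (2 * cauchy_weight v - 1) ^ (2 * k) * cauchy_weight v \<partial>lborel) = pi * fact (2 * k) / (2 ^ (2 * k) * (fact k)\<^sup>2)"
  "(\<integral>v. (2 * cauchy_weight v - 1) ^ (2 * k + 1) * cauchy_weight v \<partial>lborel) = 0"
proof (induction k)
  case (Suc k)
  let ?M = "\<lambda>n. \<integral>v. (2 * cauchy_weight v - 1) ^ n * cauchy_weight v \<partial>lborel"
  have "?M (2 * k + 2) = real (2 * k + 1) / real (2 * k + 2) * ?M (2 * k)"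
    using cauchy_moment_Suc_Suc[of "2 * k"] by (simp add: field_simps)
  also have "\<dots> = pi * fact (2 * k + 2) / (2 ^ (2 * k + 2) * (fact (k + 1))\<^sup>2)"
    unfolding Suc.IH by (simp add: fact_reduce power2_eq_square divide_simps) (simp add: algebra_simps)
  finally show "?M (2 * Suc k) = pi * fact (2 * Suc k) / (2 ^ (2 * Suc k) * (fact (Suc k))\<^sup>2)"
    by simp
  show "?M (2 * Suc k + 1) = 0"
    using cauchy_moment_Suc_Suc[of "2 * k + 1"] Suc.IH(2) by simp
qed (simp_all add: integral_cauchy_weight cauchy_moment_1)

text \<open>\<open>bessel_I\<close> is a bare \<open>suminf\<close>, so convergence has to be
  supplied: as (k!)^2 >= k!, the series is dominated by that of exp((x/2)^2).\<close>

lemma bessel_I_0_sums: "(\<lambda>k. (x / 2) ^ (2 * k) / (fact k)\<^sup>2) sums bessel_I 0 x"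
proof -
  have "summable (\<lambda>k. (x / 2) ^ (2 * k) / (fact k)\<^sup>2)"
  proof (rule summable_comparison_test')
    show "summable (\<lambda>k. inverse (fact k) * ((x / 2)\<^sup>2) ^ k)" by (rule summable_exp)
    show "norm ((x / 2) ^ (2 * k) / (fact k)\<^sup>2) \<le> inverse (fact k) * ((x / 2)\<^sup>2) ^ k" for k
    proof -
      have "(fact k :: real) \<le> (fact k)\<^sup>2" 
        by (simp add: power2_eq_square fact_ge_1)
      hence "inverse ((fact k :: real)\<^sup>2) \<le> inverse (fact k)"
        by (intro le_imp_inverse_le) simp_all
      hence "inverse ((fact k :: real)\<^sup>2) * ((x / 2)\<^sup>2) ^ k \<le> inverse (fact k) * ((x / 2)\<^sup>2) ^ k"
        by (intro mult_right_mono) simp_all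
      moreover have "norm ((x / 2) ^ (2 * k) / (fact k)\<^sup>2) = inverse ((fact k)\<^sup>2) * ((x / 2)\<^sup>2) ^ k"
        unfolding power_mult real_norm_def by (subst abs_of_nonneg) (simp, rule divide_inverse_commute)
      ultimately show ?thesis by (simp only:)
    qed
  qed
  moreover have "bessel_I 0 x = (\<Sum>k. (x / 2) ^ (2 * k) / (fact k)\<^sup>2)"
    unfolding bessel_I_def power2_eq_square add_0_right ..
  ultimately show ?thesis
    by (simp only: summable_sums)
qed

text \<open>The exponential of -2x (2 w - 1) is expanded and integrated termwise; since |2 w - 1| <=
  1, the exponential series at |2x| dominates. The (2k)! in the even moments cancels the one in the
  exponential series, which leaves pi x^(2k) / (k!)^2.\<close>

lemma bessel_I_0_cauchy:
  "(\<integral>v. exp (- (x * (4 * cauchy_weight v))) * cauchy_weight v \<partial>lborel) = pi * (exp (- 2 * x) * bessel_I 0 (2 * x))"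
proof -
  let ?w = cauchy_weight and ?c = "\<lambda>v. 2 * cauchy_weight v - 1"
  let ?a = "\<lambda>n. (- (2 * x)) ^ n / fact n"
  let ?M = "\<lambda>n. \<integral>v. ?c v ^ n * ?w v \<partial>lborel"
  let ?f = "\<lambda>n v. ?a n * (?c v ^ n * ?w v)"
  have exp_sum: "(\<lambda>n. ?f n v) sums (exp (- (2 * x) * ?c v) * ?w v)" for v
  proof -
    have "(\<lambda>n. (- (2 * x) * ?c v) ^ n /\<^sub>R fact n * ?w v) sums (exp (- (2 * x) * ?c v) * ?w v)"
      by (intro sums_mult2 exp_converges)
    also have "(\<lambda>n. (- (2 * x) * ?c v) ^ n /\<^sub>R fact n * ?w v) = (\<lambda>n. ?f n v)"
      unfolding power_mult_distrib by (simp add: fun_eq_iff divide_inverse mult_ac)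
    finally show ?thesis .
  qed
  have abs_summable: "summable (\<lambda>n. \<bar>2 * x\<bar> ^ n / fact n)"
    using summable_exp[of "\<bar>2 * x\<bar>"] by (simp add: field_simps)
  have norm_le: "norm (?f n v) \<le> \<bar>2 * x\<bar> ^ n / fact n * ?w v" for n v
  proof -
    have "\<bar>?c v\<bar> ^ n \<le> 1"
      using abs_two_cauchy_weight_minus_1[of v] by (intro power_le_one) simp_all
    hence "\<bar>?c v\<bar> ^ n * ?w v \<le> ?w v"
      using cauchy_weight_pos[of v] by (intro mult_left_le_one_le) auto
    hence "\<bar>2 * x\<bar> ^ n / fact n * (\<bar>?c v\<bar> ^ n * ?w v) \<le> \<bar>2 * x\<bar> ^ n / fact n * ?w v"
      by (intro mult_left_mono) auto
    thus ?thesis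
      using cauchy_weight_pos[of v] by (simp add: abs_mult power_abs)
  qed
  have int: "integrable lborel (?f n)" for n
    by (intro integrable_mult_right integrable_cauchy_moment)
  have sum1: "AE v in lborel. summable (\<lambda>n. norm (?f n v))"
  proof (rule AE_I2)
    fix v
    show "summable (\<lambda>n. norm (?f n v))"
      by (rule summable_comparison_test'[OF summable_mult2[OF abs_summable, of "?w v"]])
         (use norm_le in simp)
  qed
  have sum2: "summable (\<lambda>n. \<integral>v. norm (?f n v) \<partial>lborel)"
  proof (rule summable_comparison_test'[OF summable_mult2[OF abs_summable, of pi]])
    fix n
    have "(\<integral>v. norm (?f n v) \<partial>lborel) \<le> (\<integral>v. \<bar>2 * x\<bar> ^ n / fact n * ?w v \<partial>lborel)"
      by (intro integral_mono integrable_norm int integrable_mult_right integrable_cauchy_weight norm_le)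
    also have "\<dots> = \<bar>2 * x\<bar> ^ n / fact n * pi"
      by (simp add: integral_cauchy_weight)
    finally show "norm (\<integral>v. norm (?f n v) \<partial>lborel) \<le> \<bar>2 * x\<bar> ^ n / fact n * pi"
      by simp
  qed
  have "(\<lambda>n. \<integral>v. ?f n v \<partial>lborel) sums (\<integral>v. (\<Sum>n. ?f n v) \<partial>lborel)"
    by (rule sums_integral[OF int sum1 sum2])
  also have "(\<integral>v. (\<Sum>n. ?f n v) \<partial>lborel) = (\<integral>v. exp (- (2 * x) * ?c v) * ?w v \<partial>lborel)"
    using exp_sum by (simp add: sums_iff)
  also have "(\<lambda>n. \<integral>v. ?f n v \<partial>lborel) = (\<lambda>n. ?a n * ?M n)"
    by simp
  finally have sums1: "(\<lambda>n. ?a n * ?M n) sums (\<integral>v. exp (- (2 * x) * ?c v) * ?w v \<partial>lborel)" .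
  \<comment> \<open>The odd moments vanish, so the series can be reindexed by the even
    exponents.\<close>
  have "(\<lambda>k. ?a (2 * k) * ?M (2 * k)) sums (\<integral>v. exp (- (2 * x) * ?c v) * ?w v \<partial>lborel)"
  proof -
    have "strict_mono (\<lambda>k::nat. 2 * k)" by (auto simp: strict_mono_def)
    moreover have "?a n * ?M n = 0" if "n \<notin> range (\<lambda>k. 2 * k)" for n
    proof -
      have "odd n" using that by (auto elim!: evenE)
      thus ?thesis using cauchy_moment(2) by (auto elim!: oddE)
    qed
    ultimately show ?thesis
      using sums_mono_reindex[of "\<lambda>k. 2 * k" "\<lambda>n. ?a n * ?M n"] sums1 by auto
  qed
  also have "(\<lambda>k. ?a (2 * k) * ?M (2 * k)) = (\<lambda>k. pi * ((2 * x / 2) ^ (2 * k) / (fact k)\<^sup>2))"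
    by (simp only: cauchy_moment(1)) (simp add: fun_eq_iff power_mult_distrib)
  finally have I: "(\<integral>v. exp (- (2 * x) * ?c v) * ?w v \<partial>lborel) = pi * bessel_I 0 (2 * x)"
    using sums_mult[OF bessel_I_0_sums[of "2 * x"], of pi] sums_unique2 by blast
  \<comment> \<open>4 w = 2 + 2 (2 w - 1) splits off the factor e^(-2x).\<close>
  have "(\<integral>v. exp (- (x * (4 * ?w v))) * ?w v \<partial>lborel) =
          (\<integral>v. exp (- 2 * x) * (exp (- (2 * x) * ?c v) * ?w v) \<partial>lborel)"
    by (intro Bochner_Integration.integral_cong refl)
       (simp add: mult_exp_exp mult.assoc[symmetric], simp add: algebra_simps)
  also have "\<dots> = exp (- 2 * x) * (\<integral>v. exp (- (2 * x) * ?c v) * ?w v \<partial>lborel)"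
    by (rule integral_mult_right_zero)
  also have "\<dots> = pi * (exp (- 2 * x) * bessel_I 0 (2 * x))"
    unfolding I by (simp only: mult_ac)
  finally show ?thesis .
qed

subsection \<open>Evaluation of the defining integral\<close>

lemma of_real_powr_eq_exp: "r > 0 \<Longrightarrow> complex_of_real r powr a = exp (a * of_real (ln r))"
  by (simp add: powr_def Ln_of_real)

text \<open>The integrand of the Gamma integral with rate c. The cutoff to x > 0 is built in, so
  that all integrals run over the whole of \<open>lborel\<close>, as the Fubini arguments
  require.\<close>

definition gamma_kernel :: "complex \<Rightarrow> real \<Rightarrow> real \<Rightarrow> complex" where
  "gamma_kernel z c x = indicator {0<..} x *\<^sub>R (of_real x powr (z - 1) * of_real (exp (- (x * c))))"

text \<open>Transfers Euler's integral from gauge integration to the Bochner integral over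
  \<open>lborel\<close>, in which the exchanges of integrals are carried out.\<close>

lemma has_integral_gamma_kernel_1:
  assumes "Re z > 0"
  shows "has_bochner_integral lborel (gamma_kernel z 1) (Gamma z)"
proof -
  have eq: "gamma_kernel z 1 x = indicator {0<..} x *\<^sub>R (of_real x powr (z - 1) / of_real (exp x))" for x
    by (simp add: gamma_kernel_def exp_minus divide_inverse)
  have meas: "gamma_kernel z 1 \<in> borel_measurable borel"
    unfolding gamma_kernel_def[abs_def] powr_def by measurable
  have "integrable lebesgue (gamma_kernel z 1)"
    using absolutely_integrable_Gamma_integral'[OF assms] by (simp add: set_integrable_def eq[abs_def])
  hence int: "integrable lborel (gamma_kernel z 1)"
    using meas by (simp add: integrable_completion)
  have "(gamma_kernel z 1 has_integral Gamma z) UNIV"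
    using Gamma_integral_complex'[OF assms] unfolding has_integral_restrict_UNIV[of "{0<..}", symmetric]
    by (rule has_integral_eq[rotated]) (simp add: eq indicator_def)
  moreover have "(gamma_kernel z 1 has_integral (\<integral>x. gamma_kernel z 1 x \<partial>lborel)) UNIV"
    using has_integral_integral_lborel[OF int] .
  ultimately show ?thesis
    using int has_integral_unique by (auto simp: has_bochner_integral_iff)
qed

text \<open>The shape \<open>0 + c * x\<close> is that of the affine substitution rule for
  \<open>lborel\<close>, with translation 0.\<close>

lemma gamma_kernel_scale:
  assumes "c > 0"
  shows "gamma_kernel z 1 (0 + c * x) = of_real c powr (z - 1) * gamma_kernel z c x"
proof (cases "x > 0")
  case True
  hence "of_real (c * x) powr (z - 1) = of_real c powr (z - 1) * (of_real x powr (z - 1) :: complex)"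
    using assms by (simp only: of_real_powr_eq_exp mult_pos_pos ln_mult_pos of_real_add distrib_left exp_add)
  thus ?thesis using True assms by (simp add: gamma_kernel_def mult.commute)
qed (use assms in \<open>simp add: gamma_kernel_def zero_less_mult_iff\<close>)

text \<open>Substituting c x for x gives c^(1-z) from the kernel and 1/c from the measure, together
  c^(-z).\<close>

lemma has_integral_gamma_kernel:
  assumes "Re z > 0" "c > 0"
  shows "has_bochner_integral lborel (gamma_kernel z c) (Gamma z * of_real c powr (-z))"
proof -
  let ?k = "complex_of_real c powr (z - 1)"
  have k: "?k \<noteq> 0" using assms by simp
  have "has_bochner_integral lborel (\<lambda>x. ?k * gamma_kernel z c x) (Gamma z /\<^sub>R \<bar>c\<bar>)"
    using lborel_has_bochner_integral_real_affine_iff[of c "gamma_kernel z 1" "Gamma z" 0]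
      has_integral_gamma_kernel_1[OF assms(1)] assms(2)
    by (simp only: gamma_kernel_scale)
  hence "has_bochner_integral lborel (\<lambda>x. inverse ?k * (?k * gamma_kernel z c x)) (inverse ?k * (Gamma z /\<^sub>R \<bar>c\<bar>))"
    by (rule has_bochner_integral_mult_right)
  also have "(\<lambda>x. inverse ?k * (?k * gamma_kernel z c x)) = gamma_kernel z c"
    using k by (simp add: fun_eq_iff mult.assoc[symmetric])
  also have "inverse ?k * (Gamma z /\<^sub>R \<bar>c\<bar>) = Gamma z * (inverse ?k * inverse (of_real c))"
    using assms by (simp add: scaleR_conv_of_real)
  also have "inverse ?k * inverse (of_real c) = of_real c powr (-z)"
  proof -
    have c: "exp (complex_of_real (ln c)) = of_real c"
      using assms by (simp add: exp_of_real)
    have "inverse ?k * inverse (of_real c) = exp (- ((z - 1) * of_real (ln c))) * exp (- of_real (ln c))"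
      by (simp only: of_real_powr_eq_exp[OF assms(2)] exp_minus c)
    also have "\<dots> = of_real c powr (-z)"
      using assms by (simp add: of_real_powr_eq_exp mult_exp_exp algebra_simps)
    finally show ?thesis .
  qed
  finally show ?thesis .
qed

text \<open>The norm of a kernel is again a kernel, with Re z for z. Thus the evaluation above also
  yields the integrals of norms that Fubini's theorem asks for.\<close>

lemma norm_gamma_kernel: "complex_of_real (norm (gamma_kernel z c x)) = gamma_kernel (of_real (Re z)) c x"
proof (cases "x > 0")
  case True
  thus ?thesis
    by (simp add: gamma_kernel_def norm_mult norm_powr_real_powr powr_of_real[symmetric])
qed (simp add: gamma_kernel_def)

lemma has_integral_norm_gamma_kernel:
  assumes "Re z > 0" "c > 0"
  shows "has_bochner_integral lborel (\<lambda>x. norm (gamma_kernel z c x)) (Gamma (Re z) * c powr (- Re z))"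
proof -
  have "has_bochner_integral lborel (\<lambda>x. complex_of_real (norm (gamma_kernel z c x))) 
          (Gamma (of_real (Re z)) * of_real c powr (- of_real (Re z)))"
    unfolding norm_gamma_kernel using assms by (intro has_integral_gamma_kernel) simp_all
  also have "Gamma (of_real (Re z)) * of_real c powr (- of_real (Re z)) = complex_of_real (Gamma (Re z) * c powr (- Re z))"
    using assms by (simp add: Gamma_complex_of_real powr_of_real[symmetric])
  finally have "has_bochner_integral lborel (\<lambda>x. Re (complex_of_real (norm (gamma_kernel z c x))))
      (Re (complex_of_real (Gamma (Re z) * c powr (- Re z))))"
    by (rule has_bochner_integral_bounded_linear[OF bounded_linear_Re])
  thus ?thesis by simp
qed

lemma has_integral_gaussian:
  assumes "x > 0"
  shows "has_bochner_integral lborel (\<lambda>v::real. exp (- (x * v\<^sup>2))) (sqrt (pi / x))"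
proof -
  \<comment> \<open>The variance 1/(2x) gives the normal density the exponent -x v^2.\<close>
  define \<sigma> where "\<sigma> = 1 / sqrt (2 * x)"
  have \<sigma>: "\<sigma> > 0" "\<sigma>\<^sup>2 = 1 / (2 * x)"
    using assms by (simp_all add: \<sigma>_def power_divide)
  have eq: "exp (- (x * v\<^sup>2)) = sqrt (pi / x) * normal_density 0 \<sigma> v" for v
    using assms by (simp add: normal_density_def \<sigma>(2) field_simps real_sqrt_divide)
  have "has_bochner_integral lborel (normal_density 0 \<sigma>) 1"
    using \<sigma>(1) by (simp add: has_bochner_integral_iff)
  from has_bochner_integral_mult_right[OF this, of "sqrt (pi / x)"] show ?thesis
    unfolding eq by simp
qed

lemma measurable_gamma_kernel [measurable]:
  assumes [measurable]: "f \<in> borel_measurable M" "g \<in> borel_measurable M"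
  shows "(\<lambda>y. gamma_kernel z (f y) (g y)) \<in> borel_measurable M"
  unfolding gamma_kernel_def powr_def by measurable

lemma gamma_kernel_gaussian:
  "gamma_kernel p (inverse (cauchy_weight v)) x = gamma_kernel p 1 x * of_real (exp (- (x * v\<^sup>2)))"
  by (simp add: gamma_kernel_def cauchy_weight_def distrib_left exp_add[symmetric] flip: of_real_mult)

text \<open>The Gaussian integral over v contributes sqrt (pi / x); the factor x^(-1/2) lowers the
  parameter of the Gamma integral by 1/2.\<close>

lemma gamma_kernel_1_sqrt:
  "gamma_kernel p 1 x * of_real (sqrt (pi / x)) = of_real (sqrt pi) * gamma_kernel (p - 1/2) 1 x"
proof (cases "x > 0")
  case True
  have "sqrt (pi / x) = sqrt pi * x powr (- (1/2))"
    unfolding powr_minus using True by (simp add: real_sqrt_divide powr_half_sqrt field_simps)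
  hence "complex_of_real (sqrt (pi / x)) = of_real (sqrt pi) * of_real x powr of_real (- (1/2))"
    using True by (simp only: of_real_mult powr_of_real less_imp_le)
  moreover have "of_real x powr (p - 1) * of_real x powr of_real (- (1/2)) = (of_real x powr (p - 1/2 - 1) :: complex)"
    using True by (simp add: of_real_powr_eq_exp mult_exp_exp algebra_simps)
  ultimately have "of_real x powr (p - 1) * complex_of_real (sqrt (pi / x)) =
      of_real (sqrt pi) * of_real x powr (p - 1/2 - 1)"
    by (simp only: mult_ac)
  thus ?thesis
    using True by (simp add: gamma_kernel_def mult_ac)
qed (simp add: gamma_kernel_def)

lemma inverse_powr_uminus: "w > 0 \<Longrightarrow> complex_of_real (inverse w) powr (- p) = of_real w powr p"
  by (simp add: of_real_powr_eq_exp ln_inverse del: of_real_inverse)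

text \<open>\<open>Gamma p\<close> times w^p is the integral of x^(p-1) e^(-x (1 + v^2)) over x > 0.
  Integrating over v first leaves the Gamma integral with parameter p - 1/2, which converges because
  Re p > 1/2. Integrability of w^p is a by-product of Fubini's theorem.\<close>

lemma cauchy_weight_powr:
  assumes "Re p > 1/2"
  shows integrable_cauchy_weight_powr: "integrable lborel (\<lambda>v. complex_of_real (cauchy_weight v) powr p)"
    and integral_cauchy_weight_powr: "(\<integral>v. complex_of_real (cauchy_weight v) powr p \<partial>lborel) = of_real (sqrt pi) * Gamma (p - 1/2) / Gamma p"
proof -
  let ?f = "\<lambda>x v. gamma_kernel p (inverse (cauchy_weight v)) x"
  have p: "Re p > 0" "Re (p - 1/2) > 0" using assms by simp_all
  have inner_v: "has_bochner_integral lborel (?f x) (of_real (sqrt pi) * gamma_kernel (p - 1/2) 1 x)" for x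
  proof (cases "x > 0")
    case True
    show ?thesis
      unfolding gamma_kernel_gaussian gamma_kernel_1_sqrt[symmetric]
      by (intro has_bochner_integral_mult_right has_bochner_integral_of_real has_integral_gaussian True)
  qed (simp add: gamma_kernel_def has_bochner_integral_zero)
  \<comment> \<open>The Gaussian factor is positive, so the integral of the norm is the norm of the
    integral.\<close>
  have inner_v_norm: "(\<integral>v. norm (?f x v) \<partial>lborel) = norm (of_real (sqrt pi) * gamma_kernel (p - 1/2) 1 x)" for x
  proof (cases "x > 0")
    case True
    have "norm (?f x v) = norm (gamma_kernel p 1 x) * exp (- (x * v\<^sup>2))" for v
      by (simp add: gamma_kernel_gaussian norm_mult)
    hence "(\<integral>v. norm (?f x v) \<partial>lborel) = norm (gamma_kernel p 1 x) * sqrt (pi / x)"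
      using has_integral_gaussian[OF True] by (simp add: has_bochner_integral_iff)
    also have "\<dots> = norm (gamma_kernel p 1 x * of_real (sqrt (pi / x)))"
      using True by (simp add: norm_mult)
    finally show ?thesis by (simp only: gamma_kernel_1_sqrt)
  qed (simp add: gamma_kernel_def)
  have inner_x: "has_bochner_integral lborel (\<lambda>x. ?f x v) (Gamma p * of_real (cauchy_weight v) powr p)" for v
    using has_integral_gamma_kernel[OF p(1), of "inverse (cauchy_weight v)"] cauchy_weight_pos[of v]
    by (simp only: inverse_powr_uminus) simp
  have int: "integrable (lborel \<Otimes>\<^sub>M lborel) (case_prod ?f)"
  proof (rule lborel_pair.Fubini_integrable)
    show "case_prod ?f \<in> borel_measurable (lborel \<Otimes>\<^sub>M lborel)" by measurable
    show "integrable lborel (\<lambda>x. \<integral>v. norm (case (x, v) of (x, v) \<Rightarrow> ?f x v) \<partial>lborel)"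
      unfolding prod.case inner_v_norm
      using has_integral_gamma_kernel_1[OF p(2)]
      by (intro integrable_norm integrable_mult_right) (simp add: has_bochner_integral_iff)
    show "AE x in lborel. integrable lborel (\<lambda>v. case (x, v) of (x, v) \<Rightarrow> ?f x v)"
      using inner_v by (simp add: has_bochner_integral_iff)
  qed
  have G: "Gamma p \<noteq> 0"
    using p(1) by (auto simp: Gamma_eq_zero_iff elim!: nonpos_Ints_cases)
  have "integrable lborel (\<lambda>v. \<integral>x. ?f x v \<partial>lborel)"
    by (rule lborel_pair.integrable_snd[OF int])
  hence "integrable lborel (\<lambda>v. Gamma p * of_real (cauchy_weight v) powr p)"
    using inner_x by (simp add: has_bochner_integral_iff)
  hence "integrable lborel (\<lambda>v. inverse (Gamma p) * (Gamma p * of_real (cauchy_weight v) powr p))"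
    by (rule integrable_mult_right)
  thus "integrable lborel (\<lambda>v. complex_of_real (cauchy_weight v) powr p)"
    using G by (simp add: mult.assoc[symmetric])
  have "(\<integral>v. \<integral>x. ?f x v \<partial>lborel \<partial>lborel) = (\<integral>x. \<integral>v. ?f x v \<partial>lborel \<partial>lborel)"
    by (rule lborel_pair.Fubini_integral[OF int])
  also have "\<dots> = of_real (sqrt pi) * Gamma (p - 1/2)"
    using inner_v has_integral_gamma_kernel_1[OF p(2)] by (simp add: has_bochner_integral_iff)
  finally have "Gamma p * (\<integral>v. complex_of_real (cauchy_weight v) powr p \<partial>lborel) = of_real (sqrt pi) * Gamma (p - 1/2)"
    using inner_x by (simp add: has_bochner_integral_iff)
  thus "(\<integral>v. complex_of_real (cauchy_weight v) powr p \<partial>lborel) = of_real (sqrt pi) * Gamma (p - 1/2) / Gamma p"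
    using G by (simp add: field_simps)
qed

lemma integrable_cauchy_weight_powr_real:
  assumes "p > 1/2"
  shows "integrable lborel (\<lambda>v. cauchy_weight v powr p)"
proof -
  have "integrable lborel (\<lambda>v. complex_of_real (cauchy_weight v) powr of_real p)"
    using assms by (intro integrable_cauchy_weight_powr) simp
  hence "integrable lborel (\<lambda>v. complex_of_real (cauchy_weight v powr p))"
    using cauchy_weight_pos by (simp add: powr_of_real less_imp_le)
  from integrable_Re[OF this] show ?thesis by simp
qed

text \<open>With the Bessel function replaced by its integral over v, the integration over t comes
  first and gives Gamma(s) (4w)^(-s) w = Gamma(s) 4^(-s) w^(1-s). The factor Gamma(s) cancels the
  one in front of the defining integral.\<close>

lemma zeta_Z_integral_eq:
  assumes s: "0 < Re s" "Re s < 1/2"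
  shows "zeta_Z_integral s = zeta_Z_formula s"
proof -
  let ?w = cauchy_weight
  let ?f = "\<lambda>v x. gamma_kernel s (4 * ?w v) x * of_real (?w v)"
  have inner_x: "has_bochner_integral lborel (?f v) (Gamma s * 4 powr (-s) * of_real (?w v) powr (1 - s))" for v
  proof -
    have "has_bochner_integral lborel (?f v) (Gamma s * of_real (4 * ?w v) powr (-s) * of_real (?w v))"
      using has_integral_gamma_kernel[OF s(1), of "4 * ?w v"] cauchy_weight_pos[of v]
      by (intro has_bochner_integral_mult_left) simp_all
    also have "Gamma s * of_real (4 * ?w v) powr (-s) * of_real (?w v) = Gamma s * 4 powr (-s) * of_real (?w v) powr (1 - s)"
    proof -
      have w: "exp (complex_of_real (ln (?w v))) = of_real (?w v)"
        using cauchy_weight_pos[of v] by (simp add: exp_of_real)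
      have "of_real (4 * ?w v) powr (-s) * of_real (?w v) = exp (-s * of_real (ln (4 * ?w v))) * exp (of_real (ln (?w v)))"
        using cauchy_weight_pos[of v] by (simp only: of_real_powr_eq_exp mult_pos_pos zero_less_numeral w)
      also have "\<dots> = exp (-s * of_real (ln 4)) * exp ((1 - s) * of_real (ln (?w v)))"
        using cauchy_weight_pos[of v] by (simp add: mult_exp_exp ln_mult_pos algebra_simps)
      also have "\<dots> = of_real 4 powr (-s) * of_real (?w v) powr (1 - s)"
        using cauchy_weight_pos[of v] by (simp only: of_real_powr_eq_exp zero_less_numeral)
      finally show ?thesis by (simp add: mult.assoc)
    qed
    finally show ?thesis .
  qed
  have norm_inner_x: "(\<integral>x. norm (?f v x) \<partial>lborel) = Gamma (Re s) * 4 powr (- Re s) * ?w v powr (1 - Re s)" for v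
  proof -
    have w: "?w v > 0" by (rule cauchy_weight_pos)
    have "(\<integral>x. norm (?f v x) \<partial>lborel) = Gamma (Re s) * ((4 * ?w v) powr (- Re s) * ?w v)"
      using has_integral_norm_gamma_kernel[OF s(1), of "4 * ?w v"] w
      by (simp add: norm_mult has_bochner_integral_iff)
    also have "(4 * ?w v) powr (- Re s) * ?w v = 4 powr (- Re s) * ?w v powr (1 - Re s)"
      using w by (simp add: powr_mult powr_diff powr_minus divide_inverse)
    finally show ?thesis by (simp only: mult.assoc)
  qed
  have int: "integrable (lborel \<Otimes>\<^sub>M lborel) (case_prod ?f)"
  proof (rule lborel_pair.Fubini_integrable)
    show "case_prod ?f \<in> borel_measurable (lborel \<Otimes>\<^sub>M lborel)" by measurable
    show "integrable lborel (\<lambda>v. \<integral>x. norm (case (v, x) of (v, x) \<Rightarrow> ?f v x) \<partial>lborel)"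
      unfolding prod.case norm_inner_x
      using s by (intro integrable_mult_right integrable_cauchy_weight_powr_real) simp
    show "AE v in lborel. integrable lborel (\<lambda>x. case (v, x) of (v, x) \<Rightarrow> ?f v x)"
      using inner_x by (simp add: has_bochner_integral_iff)
  qed
  have inner_v: "(\<integral>v. ?f v x \<partial>lborel) = 
      of_real pi * indicator {0<..} x *\<^sub>R (of_real (exp (- 2 * x) * bessel_I 0 (2 * x)) * of_real x powr s / of_real x)" for x
  proof (cases "x > 0")
    case True
    have "(\<integral>v. ?f v x \<partial>lborel) = (\<integral>v. of_real x powr (s - 1) * complex_of_real (exp (- (x * (4 * ?w v))) * ?w v) \<partial>lborel)"
      using True by (simp add: gamma_kernel_def mult.assoc)
    also have "\<dots> = of_real x powr (s - 1) * of_real (pi * (exp (- 2 * x) * bessel_I 0 (2 * x)))"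
      by (simp only: integral_mult_right_zero integral_complex_of_real bessel_I_0_cauchy)
    also have "of_real x powr (s - 1) = complex_of_real x powr s / of_real x"
      using True by (simp add: powr_diff)
    finally show ?thesis using True by (simp add: mult_ac)
  qed (simp add: gamma_kernel_def)
  have Gs: "Gamma s \<noteq> 0" 
    using s by (auto simp: Gamma_eq_zero_iff elim!: nonpos_Ints_cases)
  have "of_real pi * (Gamma s * zeta_Z_integral s) = (\<integral>x. \<integral>v. ?f v x \<partial>lborel \<partial>lborel)"
    unfolding inner_v integral_mult_right_zero zeta_Z_integral_def set_lebesgue_integral_def
    using Gs by simp
  also have "\<dots> = (\<integral>v. \<integral>x. ?f v x \<partial>lborel \<partial>lborel)"
    by (rule lborel_pair.Fubini_integral[OF int])
  also have "\<dots> = Gamma s * 4 powr (-s) * (\<integral>v. of_real (?w v) powr (1 - s) \<partial>lborel)"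
    using inner_x by (simp add: has_bochner_integral_iff)
  also have "(\<integral>v. complex_of_real (?w v) powr (1 - s) \<partial>lborel) = of_real (sqrt pi) * Gamma (1/2 - s) * rGamma (1 - s)"
  proof -
    have "1 - s - 1/2 = 1/2 - s" by simp
    with integral_cauchy_weight_powr[of "1 - s"] s show ?thesis
      by (simp only: rGamma_inverse_Gamma divide_inverse[of _ "Gamma _"]) simp
  qed
  finally have "of_real pi * zeta_Z_integral s = 4 powr (-s) * (of_real (sqrt pi) * Gamma (1/2 - s) * rGamma (1 - s))"
    using Gs by simp
  \<comment> \<open>The Bessel integral brings pi to the left side and the power integral sqrt pi to
    the right; their quotient is the 1 / sqrt pi of the closed form.\<close>
  moreover have "complex_of_real pi = of_real (sqrt pi) * of_real (sqrt pi)"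
    by (simp flip: of_real_mult)
  ultimately show ?thesis
    by (simp add: zeta_Z_formula_def powr_minus field_simps)
qed

lemma zeta_Z_eq: "zeta_Z = zeta_Z_formula"
  unfolding zeta_Z_def
proof (rule the_equality, goal_cases)
  case 1
  show ?case using zeta_Z_formula_nicely_meromorphic zeta_Z_integral_eq by auto
next
  case (2 f)
  show ?case
  proof (rule nicely_meromorphic_eqI[where S = "{s. 0 < Re s} \<inter> {s. Re s < 1/2}"])
    show "open ({s. 0 < Re s} \<inter> {s. Re s < 1/2})"
      by (intro open_Int open_halfspace_Re_gt open_halfspace_Re_lt)
    have "1/4 \<in> {s. 0 < Re s} \<inter> {s. Re s < 1/2}" by simp
    thus "{s. 0 < Re s} \<inter> {s. Re s < 1/2} \<noteq> {}" by blast
  qed (use 2 zeta_Z_formula_nicely_meromorphic zeta_Z_integral_eq in auto)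
qed

section \<open>Values of Z at nonpositive integers and their product\<close>

lemma Z_fun_minus_nat:
  "Z_fun (- of_nat j) = of_real (sqrt pi * Gamma ((real j + 1) / 2) / Gamma ((real j + 2) / 2))"
proof -
  \<comment> \<open>This cancels the power of 4 in the closed form at s = -j/2. Both Gamma arguments
    are positive there, so no value at a pole is involved.\<close>
  have "(2 :: complex) powr (- of_nat j) = inverse (4 powr (of_nat j / 2))"
  proof -
    have "ln (4 :: real) = 2 * ln 2"
      using ln_realpow[of 2 2] by simp
    thus ?thesis
      using of_real_powr_eq_exp[of 2 "- of_nat j"] of_real_powr_eq_exp[of 4 "of_nat j / 2"]
      by (simp add: exp_minus)
  qed
  hence "Z_fun (- of_nat j) = of_real pi * Gamma (1/2 + of_nat j / 2) * rGamma (1 + of_nat j / 2) / of_real (sqrt pi)"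
    unfolding Z_fun_def zeta_Z_eq zeta_Z_formula_def by (simp add: powr_minus)
  also have "1/2 + of_nat j / 2 = complex_of_real ((real j + 1) / 2)"
    by (simp add: add_divide_distrib)
  also have "1 + of_nat j / 2 = complex_of_real ((real j + 2) / 2)"
    by (simp add: add_divide_distrib)
  also have "of_real pi * Gamma (complex_of_real ((real j + 1) / 2)) * rGamma (complex_of_real ((real j + 2) / 2)) / of_real (sqrt pi) =
      complex_of_real (pi / sqrt pi * Gamma ((real j + 1) / 2) / Gamma ((real j + 2) / 2))"
    by (simp only: Gamma_complex_of_real rGamma_inverse_Gamma) (simp add: divide_simps)
  also have "pi / sqrt pi = sqrt pi" by (rule real_div_sqrt) simp
  finally show ?thesis .
qed

text \<open>The denominator \<open>Gamma ((real j + 2) / 2)\<close> of one factor is the Gamma value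
  in the numerator of the next. The empty product is covered because Gamma(1/2) = sqrt pi.\<close>

lemma prod_Z_fun:
  "(\<Prod>j<n. Z_fun (- of_nat j)) = of_real (pi powr ((real n + 1) / 2) / Gamma ((real n + 1) / 2))"
proof (induction n)
  case 0
  show ?case by (simp add: Gamma_one_half_real powr_half_sqrt)
next
  case (Suc n)
  have "(real n + 1) / 2 > 0" by simp
  from Gamma_real_pos[OF this] have "Gamma ((real n + 1) / 2) \<noteq> 0"
    by linarith
  moreover have "pi powr ((real n + 1) / 2) * sqrt pi = pi powr ((real n + 2) / 2)"
    by (simp add: powr_half_sqrt[symmetric] powr_add[symmetric] add_divide_distrib add.commute)
  ultimately have "pi powr ((real n + 1) / 2) / Gamma ((real n + 1) / 2) *
      (sqrt pi * Gamma ((real n + 1) / 2) / Gamma ((real n + 2) / 2)) =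
      pi powr ((real n + 2) / 2) / Gamma ((real n + 2) / 2)"
    by simp
  moreover have "real n + 2 = real (Suc n) + 1" by simp
  ultimately show ?case
    unfolding prod.lessThan_Suc Suc.IH by (simp only: Z_fun_minus_nat of_real_mult[symmetric])
qed

section \<open>The volume measure of the sphere\<close>

subsection \<open>Euclidean space with one additional coordinate\<close>

text \<open>
  The change of variables theorem of the library needs a well-ordered index type, so the cone map is
  written on \<open>real^'n aug\<close>, with an arbitrary order on \<open>'n aug\<close>, instead of \<open>real^'m\<close>.
\<close>

datatype 'a aug = Apex | Coord 'a

lemma UNIV_aug: "UNIV = insert Apex (range Coord)"
  by (auto intro: aug.exhaust)

instance aug :: (finite) finite
  by standard (simp add: UNIV_aug)

lemma inj_Coord: "inj Coord"
  by (auto simp: inj_def)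

lemma CARD_aug: "CARD('n::finite aug) = CARD('n) + 1"
  by (simp add: UNIV_aug card_image inj_Coord image_iff)

lemma sum_aug: "(\<Sum>k\<in>UNIV. f (k :: 'n::finite aug)) = f Apex + (\<Sum>i\<in>UNIV. f (Coord i))"
  by (simp add: UNIV_aug sum.reindex[OF inj_Coord] image_iff)

lemma prod_aug: "(\<Prod>k\<in>UNIV. f (k :: 'n::finite aug)) = f Apex * (\<Prod>i\<in>UNIV. f (Coord i))"
  by (simp add: UNIV_aug prod.reindex[OF inj_Coord] image_iff)

fun aug_rank :: "'a::countable aug \<Rightarrow> nat" where
  "aug_rank Apex = 0"
| "aug_rank (Coord i) = Suc (to_nat i)"

lemma aug_rank_inj: "aug_rank x = aug_rank y \<Longrightarrow> x = y"
  by (cases x; cases y) auto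

instantiation aug :: (countable) wellorder
begin
definition less_eq_aug :: "'a aug \<Rightarrow> 'a aug \<Rightarrow> bool" where
  "less_eq_aug x y \<longleftrightarrow> aug_rank x \<le> aug_rank y"
definition less_aug :: "'a aug \<Rightarrow> 'a aug \<Rightarrow> bool" where
  "less_aug x y \<longleftrightarrow> aug_rank x < aug_rank y"
instance
proof
  fix P :: "'a aug \<Rightarrow> bool" and a
  assume *: "\<And>x. (\<And>y. y < x \<Longrightarrow> P y) \<Longrightarrow> P x"
  have "P x" if "aug_rank x < n" for x n
    using that
  proof (induction n arbitrary: x)
    case (Suc n)
    show ?case by (rule *, rule Suc.IH) (use Suc.prems in \<open>simp add: less_aug_def\<close>)
  qed simp
  thus "P a" by blast
qed (auto simp: less_eq_aug_def less_aug_def intro: aug_rank_inj)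
end

text \<open>In the Leibniz expansion, a permutation that moves \<open>Apex\<close> picks a zero of
  the \<open>Apex\<close> row. The others fix \<open>Apex\<close> and correspond, with equal sign,
  to the permutations of \<open>'n\<close>.\<close>

lemma det_block_aug:
  fixes A :: "real^'n::finite aug^'n aug"
  assumes "A $ Apex $ Apex = 1" "\<And>i. A $ Apex $ Coord i = 0"
  shows "det A = det (\<chi> i j. A $ Coord i $ Coord j)"
proof -
  let ?P = "{p. p permutes (UNIV :: 'n aug set)}"
  let ?t = "\<lambda>p. of_int (sign p) * (\<Prod>k\<in>UNIV. A $ k $ p k)"
  define E where "E = map_permutation (UNIV :: 'n set) Coord"
  have E_Coord: "E q (Coord i) = Coord (q i)" for q i
    unfolding E_def by (subst map_permutation_apply) (auto simp: inj_Coord)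
  have E_Apex: "E q Apex = Apex" for q
    unfolding E_def map_permutation_def by (auto simp: restrict_id_def)
  have E_perm: "E q permutes range Coord" if "q permutes UNIV" for q
    unfolding E_def using that
    by (intro map_permutation_permutes) (auto simp: bij_betw_def inj_Coord)
  have sign_E: "sign (E q) = sign q" if "q permutes UNIV" for q
    unfolding E_def using that by (intro sign_map_permutation) (auto simp: inj_Coord)
  have E_inj: "inj_on E {q. q permutes UNIV}"
    by (rule inj_onI) (metis E_Coord aug.inject ext)
  have "det A = (\<Sum>p\<in>?P. ?t p)"
    by (simp add: det_def)
  also have "\<dots> = (\<Sum>p\<in>{p. p permutes (range Coord :: 'n aug set)}. ?t p)"
  proof (rule sum.mono_neutral_right)
    show "finite ?P" by (simp add: finite_permutations)
    show "{p. p permutes (range Coord :: 'n aug set)} \<subseteq> ?P"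
      using permutes_subset[of _ "range Coord" UNIV] by blast
    show "\<forall>p\<in>?P - {p. p permutes range Coord}. ?t p = 0"
    proof
      fix p :: "'n aug \<Rightarrow> 'n aug"
      assume p: "p \<in> ?P - {p. p permutes range Coord}"
      have "p Apex \<noteq> Apex"
      proof
        assume "p Apex = Apex"
        moreover have "x = Apex" if "x \<notin> range Coord" for x :: "'n aug"
          using that by (cases x) auto
        ultimately have "p permutes range Coord"
          using p permutes_superset[of p UNIV "range Coord"] by auto
        thus False using p by simp
      qed
      then obtain i where "p Apex = Coord i" by (cases "p Apex") auto
      hence "A $ Apex $ p Apex = 0" using assms by simp
      thus "?t p = 0" by (simp add: prod_aug)
    qed
  qed
  also have "{p. p permutes (range Coord :: 'n aug set)} = E ` {q. q permutes UNIV}"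
  proof (intro equalityI subsetI)
    fix p :: "'n aug \<Rightarrow> 'n aug" assume p: "p \<in> {p. p permutes range Coord}"
    define q where "q = map_permutation (range Coord) (inv Coord) p"
    have "q permutes UNIV"
      unfolding q_def using p
      by (intro map_permutation_permutes)
         (auto simp: inj_Coord bij_betw_inv_into bij_betw_def inj_on_inv_into image_inv_f_f)
    moreover have "E q = p"
      unfolding E_def q_def using p
      by (intro map_permutation_compose_inv) 
         (auto simp: inj_Coord bij_betw_def inj_on_inv_into f_inv_into_f)
    ultimately show "p \<in> E ` {q. q permutes UNIV}" by auto
  qed (auto dest: E_perm)
  also have "sum ?t (E ` {q. q permutes UNIV}) = (\<Sum>q\<in>{q. q permutes UNIV}. ?t (E q))"
    using E_inj by (simp add: sum.reindex)
  also have "\<dots> = (\<Sum>q\<in>{q. q permutes UNIV}. of_int (sign q) * (\<Prod>i\<in>UNIV. A $ Coord i $ Coord (q i)))"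
    by (intro sum.cong refl)
       (simp add: prod_aug E_Apex E_Coord assms sign_E)
  also have "\<dots> = det (\<chi> i j. A $ Coord i $ Coord j)"
    by (simp add: det_def)
  finally show ?thesis .
qed

text \<open>Lebesgue measure is determined by its values on boxes, and renaming coordinates only
  permutes the side lengths. This carries volumes between \<open>real^'m\<close> and
  \<open>real^'n aug\<close>.\<close>

lemma lborel_permute_coords:
  fixes e :: "'m::finite \<Rightarrow> 'k::finite"
  assumes "bij e"
  shows "distr lborel borel (\<lambda>x :: real^'k. \<chi> j. x $ e j) = (lborel :: (real^'m) measure)"
proof (rule sym, rule lborel_eqI)
  fix l u :: "real^'m"
  assume le: "\<And>b. b \<in> Basis \<Longrightarrow> l \<bullet> b \<le> u \<bullet> b"
  let ?T = "\<lambda>x :: real^'k. \<chi> j. x $ e j"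
  let ?p = "\<lambda>x :: real^'m. \<chi> k. x $ inv e k"
  have [measurable]: "?T \<in> borel_measurable borel"
    by (intro borel_measurable_continuous_onI continuous_intros)
  have pre: "?T -` box l u = box (?p l) (?p u)"
    using assms by (auto simp: mem_box_cart bij_inv_eq_iff) (metis assms bij_inv_eq_iff)+
  have le': "l $ j \<le> u $ j" for j
    using le[of "axis j 1"] by (simp add: inner_axis)
  have "emeasure (distr lborel borel ?T) (box l u) = emeasure lborel (box (?p l) (?p u))"
    by (simp add: emeasure_distr pre)
  also have "\<dots> = (\<Prod>b\<in>Basis. (?p u - ?p l) \<bullet> b)"
    by (subst emeasure_lborel_box) (auto simp: Basis_vec_def inner_axis le')
  also have "(\<Prod>b\<in>Basis. (?p u - ?p l) \<bullet> b) = (\<Prod>k\<in>UNIV. (?p u - ?p l) $ k)"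
    by (simp add: Basis_vec_def inner_axis axis_eq_axis prod.UNION_disjoint)
  also have "\<dots> = (\<Prod>j\<in>UNIV. (u - l) $ j)"
    using prod.reindex_bij_betw[OF assms, of "\<lambda>k. (?p u - ?p l) $ k"] assms
    by (simp add: bij_is_inj)
  also have "\<dots> = (\<Prod>b\<in>Basis. (u - l) \<bullet> b)"
    by (simp add: Basis_vec_def inner_axis axis_eq_axis prod.UNION_disjoint)
  finally show "emeasure (distr lborel borel ?T) (box l u) = (\<Prod>b\<in>Basis. (u - l) \<bullet> b)" .
qed simp

definition aug_join :: "real \<Rightarrow> real^'n \<Rightarrow> real^'n aug" where
  "aug_join r x = (\<chi> k. case k of Apex \<Rightarrow> r | Coord i \<Rightarrow> x $ i)"

definition aug_tail :: "real^'n aug \<Rightarrow> real^'n" where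
  "aug_tail y = (\<chi> i. y $ Coord i)"

lemma aug_join_simps [simp]:
  "aug_join r x $ Apex = r" "aug_join r x $ Coord i = x $ i" "aug_tail (aug_join r x) = x"
  by (simp_all add: aug_join_def aug_tail_def)

lemma aug_tail_nth [simp]: "aug_tail y $ i = y $ Coord i"
  by (simp add: aug_tail_def)

lemma bounded_linear_aug_tail: "bounded_linear (aug_tail :: real^'n::finite aug \<Rightarrow> real^'n)"
  unfolding linear_conv_bounded_linear[symmetric]
  by (rule linearI) (simp_all add: vec_eq_iff)

lemma all_aug: "(\<forall>k. P k) \<longleftrightarrow> P Apex \<and> (\<forall>i. P (Coord i))"
  by (metis aug.exhaust)

lemma measurable_aug_join [measurable]:
  "(\<lambda>(r, x). aug_join r (x :: real^'n::finite)) \<in> borel_measurable (lborel \<Otimes>\<^sub>M lborel)"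
proof -
  have "continuous_on UNIV (\<lambda>z. case k of Apex \<Rightarrow> fst z | Coord i \<Rightarrow> (snd z :: real^'n) $ i)" for k
    by (cases k) (auto intro!: continuous_intros)
  hence "continuous_on UNIV (\<lambda>z. aug_join (fst z) (snd z :: real^'n))"
    unfolding aug_join_def by (intro continuous_intros) auto
  thus ?thesis
    by (simp add: lborel_prod case_prod_beta borel_measurable_continuous_onI)
qed

lemma lborel_aug_join:
  "distr (lborel \<Otimes>\<^sub>M lborel) borel (\<lambda>(r, x). aug_join r x) = (lborel :: (real^'n::finite aug) measure)"
proof (rule sym, rule lborel_eqI)
  fix l u :: "real^'n aug"
  assume le: "\<And>b. b \<in> Basis \<Longrightarrow> l \<bullet> b \<le> u \<bullet> b"
  let ?T = "\<lambda>(r, x). aug_join r x :: real^'n aug"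
  have le': "l $ j \<le> u $ j" for j
    using le[of "axis j 1"] by (simp add: inner_axis)
  have pre: "?T -` box l u = {l $ Apex<..<u $ Apex} \<times> box (aug_tail l) (aug_tail u)"
    by (auto simp: mem_box_cart all_aug)
  have Basis_prod: "(\<Prod>b\<in>Basis. v \<bullet> b) = (\<Prod>k\<in>UNIV. v $ k)" for v :: "real^'k::finite"
    by (simp add: Basis_vec_def inner_axis axis_eq_axis prod.UNION_disjoint)
  have "emeasure (distr (lborel \<Otimes>\<^sub>M lborel) borel ?T) (box l u) =
          emeasure (lborel \<Otimes>\<^sub>M lborel) ({l $ Apex<..<u $ Apex} \<times> box (aug_tail l) (aug_tail u))"
    by (simp add: emeasure_distr pre[symmetric] space_pair_measure)
  also have "\<dots> = emeasure lborel {l $ Apex<..<u $ Apex} * emeasure lborel (box (aug_tail l) (aug_tail u))"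
    by (rule lborel.emeasure_pair_measure_Times) auto
  also have "\<dots> = ennreal (u $ Apex - l $ Apex) * (\<Prod>b\<in>Basis. (aug_tail u - aug_tail l) \<bullet> b)"
    by (subst emeasure_lborel_box)
       (auto simp: Basis_vec_def inner_axis le')
  also have "\<dots> = ennreal ((u $ Apex - l $ Apex) * (\<Prod>i\<in>UNIV. (u - l) $ Coord i))"
    by (simp add: Basis_prod le' ennreal_mult prod_nonneg)
  also have "\<dots> = (\<Prod>b\<in>Basis. (u - l) \<bullet> b)"
    by (simp add: Basis_prod prod_aug)
  finally show "emeasure (distr (lborel \<Otimes>\<^sub>M lborel) borel ?T) (box l u) = (\<Prod>b\<in>Basis. (u - l) \<bullet> b)" .
qed simp

text \<open>Tonelli's theorem with the \<open>Apex\<close> coordinate split off; it separates the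
  radius from the chart coordinates in the cone integral.\<close>

lemma nn_integral_aug:
  fixes f :: "real^'n::finite aug \<Rightarrow> ennreal"
  assumes [measurable]: "f \<in> borel_measurable borel"
  shows "(\<integral>\<^sup>+y. f y \<partial>lborel) = (\<integral>\<^sup>+r. \<integral>\<^sup>+x. f (aug_join r x) \<partial>lborel \<partial>lborel)"
proof -
  have "(\<integral>\<^sup>+y. f y \<partial>lborel) = (\<integral>\<^sup>+z. f ((\<lambda>(r, x). aug_join r x) z) \<partial>(lborel \<Otimes>\<^sub>M lborel))"
    by (subst lborel_aug_join[symmetric], subst nn_integral_distr) auto
  also have "\<dots> = (\<integral>\<^sup>+r. \<integral>\<^sup>+x. f (aug_join r x) \<partial>lborel \<partial>lborel)"
    by (subst lborel.nn_integral_fst[symmetric]) (auto simp: split_beta')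
  finally show ?thesis .
qed

text \<open>Stated through the radial projection instead of as an image, so that measurability is
  that of a preimage. The origin, where the projection has only a default value, is left
  out.\<close>

definition unit_cone :: "(real^'m) set \<Rightarrow> (real^'m) set" where
  "unit_cone A = {y. y \<noteq> 0 \<and> norm y \<le> 1 \<and> y /\<^sub>R norm y \<in> A}"

lemma unit_cone_borel: "A \<in> sets borel \<Longrightarrow> unit_cone A \<in> sets (borel :: (real^'m::finite) measure)"
proof -
  assume A: "A \<in> sets borel"
  have "(\<lambda>y :: real^'m. y /\<^sub>R norm y) \<in> borel_measurable borel"
    by measurable
  from measurable_sets_borel[OF this A]
  have "(\<lambda>y. y /\<^sub>R norm y) -` A \<inter> (cball 0 1 - {0}) \<in> sets borel"
    by auto
  also have "(\<lambda>y. y /\<^sub>R norm y) -` A \<inter> (cball 0 1 - {0}) = unit_cone A"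
    by (auto simp: unit_cone_def)
  finally show ?thesis .
qed

section \<open>The Jacobian of the cone map\<close>

lemma det_scaleR_matrix: "det (c *\<^sub>R A) = c ^ CARD('n) * det (A :: real^'n::finite^'n)"
  by (simp add: det_def prod.distrib sum_distrib_left mult_ac)

lemma gram_density_continuous:
  fixes \<phi> :: "real^'n::finite \<Rightarrow> real^'m::finite"
  assumes "continuous_on U (\<lambda>x. matrix (frechet_derivative \<phi> (at x)))"
  shows "continuous_on U (gram_density \<phi>)"
proof -
  have "continuous_on U (\<lambda>x. matrix (frechet_derivative \<phi> (at x)) $ i $ j)" for i j
    using assms by (intro continuous_intros)
  thus ?thesis
    unfolding gram_density_def Let_def det_def matrix_matrix_mult_def transpose_def
    by (auto intro!: continuous_intros assms)
qed

text \<open>The columns of the matrix A are v and the r D(e_i), up to the renaming \<open>e\<close>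
  of the coordinates. The product of the transpose of A with A contains only their inner products,
  so the renaming disappears, and orthogonality makes it block diagonal with blocks 1 and r^2 times
  the Gram matrix of phi. Its determinant is (det A)^2.\<close>

lemma det_cone_map:
  fixes \<phi> :: "real^'n::finite \<Rightarrow> real^'m::finite" and e :: "'m \<Rightarrow> 'n aug"
  assumes e: "bij e" and r: "r \<ge> 0"
    and unit: "v \<bullet> v = 1" and orth: "\<And>h. v \<bullet> D h = 0" and D: "D = frechet_derivative \<phi> (at x)"
    and lin: "linear D"
  shows "\<bar>det (matrix (\<lambda>h. \<chi> k. (h $ Apex *\<^sub>R v + r *\<^sub>R D (aug_tail h)) $ inv e k))\<bar> = 
           r ^ CARD('n) * gram_density \<phi> x"
proof -
  let ?F = "\<lambda>h. h $ Apex *\<^sub>R v + r *\<^sub>R D (aug_tail h)"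
  let ?A = "matrix (\<lambda>h. \<chi> k. ?F h $ inv e k)"
  let ?J = "matrix D"
  have prod: "(transpose ?A ** ?A) $ k $ l = ?F (axis k 1) \<bullet> ?F (axis l 1)" for k l
  proof -
    have "(transpose ?A ** ?A) $ k $ l = (\<Sum>p\<in>UNIV. ?F (axis k 1) $ inv e p * ?F (axis l 1) $ inv e p)"
      by (simp add: matrix_matrix_mult_def transpose_def matrix_def)
    also have "\<dots> = (\<Sum>j\<in>UNIV. ?F (axis k 1) $ j * ?F (axis l 1) $ j)"
      by (rule sum.reindex_bij_betw) (simp add: e bij_imp_bij_inv)
    finally show ?thesis by (simp add: inner_vec_def)
  qed
  have tail_Apex: "aug_tail (axis Apex 1) = (0 :: real^'n)"
    by (simp add: vec_eq_iff axis_def)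
  have tail_Coord: "aug_tail (axis (Coord i) 1) = (axis i 1 :: real^'n)" for i
    by (simp add: vec_eq_iff axis_def)
  have F_Apex: "?F (axis Apex 1) = v"
    by (simp add: tail_Apex linear_0[OF lin])
  have F_Coord: "?F (axis (Coord i) 1) = r *\<^sub>R D (axis i 1)" for i
    proof -
    have "axis (Coord i) 1 $ Apex = (0 :: real)"
      by (simp add: axis_def)
    thus ?thesis by (simp add: tail_Coord)
  qed
  have "det (transpose ?A ** ?A) = det (\<chi> i j. (transpose ?A ** ?A) $ Coord i $ Coord j)"
    by (rule det_block_aug) (simp_all only: prod F_Apex F_Coord unit orth inner_scaleR_right mult_zero_right)
  also have "(\<chi> i j. (transpose ?A ** ?A) $ Coord i $ Coord j) = r\<^sup>2 *\<^sub>R (transpose ?J ** ?J)"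
    by (simp only: vec_eq_iff vec_lambda_beta prod F_Coord)
       (simp add: power2_eq_square matrix_matrix_mult_def transpose_def matrix_def
         inner_vec_def sum_distrib_left mult_ac)
  also have "det \<dots> = (r ^ CARD('n))\<^sup>2 * det (transpose ?J ** ?J)"
    by (simp only: det_scaleR_matrix power_mult [symmetric] mult.commute)
  finally have "(det ?A)\<^sup>2 = (r ^ CARD('n))\<^sup>2 * det (transpose ?J ** ?J)"
    by (simp add: det_mul power2_eq_square)
  hence "sqrt ((det ?A)\<^sup>2) = sqrt ((r ^ CARD('n))\<^sup>2 * det (transpose ?J ** ?J))"
    by simp
  thus ?thesis
    using r by (simp add: real_sqrt_mult gram_density_def D Let_def)
qed

subsection \<open>Parametrizations and cones\<close>

text \<open>An image under phi is a preimage under the continuous inverse, whose domain is a Borel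
  set because it is relatively open in M.\<close>

lemma borel_image_parametrization:
  fixes \<phi> :: "real^'n::finite \<Rightarrow> real^'m::finite"
  assumes "local_parametrization M U \<phi>" "M \<in> sets borel" "B \<in> sets borel" "B \<subseteq> U"
  shows "\<phi> ` B \<in> sets borel"
proof -
  obtain \<psi> where \<psi>: "homeomorphism U (\<phi> ` U) \<phi> \<psi>" and op: "openin (top_of_set M) (\<phi> ` U)"
    using assms by (auto simp: local_parametrization_def)
  have U: "\<phi> ` U \<in> sets borel"
    using op assms(2) by (auto simp: openin_open)
  have "\<psi> \<in> borel_measurable (restrict_space borel (\<phi> ` U))"
    using \<psi> by (intro borel_measurable_continuous_on_restrict) (auto simp: homeomorphism_def)
  from measurable_sets[OF this assms(3)] U
  have "\<psi> -` B \<inter> \<phi> ` U \<in> sets borel"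
    by (simp add: space_restrict_space sets_restrict_space_iff)
  also have "\<psi> -` B \<inter> \<phi> ` U = \<phi> ` B"
    using \<psi> assms(4) by (force simp: homeomorphism_def)
  finally show ?thesis .
qed

lemma nn_integral_power_01:
  "(\<integral>\<^sup>+r\<in>{0<..1}. ennreal (r ^ n) \<partial>lborel) = ennreal (1 / (real n + 1))"
proof -
  have "((\<lambda>r::real. r ^ n) has_integral inverse (real (Suc n)) * 1 ^ Suc n - inverse (real (Suc n)) * 0 ^ Suc n) {0..1}"
    by (intro fundamental_theorem_of_calculus)
       (auto intro!: derivative_eq_intros
             simp: has_real_derivative_iff_has_vector_derivative[symmetric] simp del: power_Suc of_nat_Suc)
  hence "((\<lambda>r::real. r ^ n) has_integral 1 / (real n + 1)) {0..1}"
    by (simp add: inverse_eq_divide add.commute)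
  hence "((\<lambda>r::real. r ^ n) has_integral 1 / (real n + 1)) {0<..1}"
    by (rule has_integral_spike_set_eq[THEN iffD1, rotated 2]) (auto intro: negligible_subset[of "{0}"])
  from nn_integral_has_integral_lebesgue'[OF _ this] show ?thesis
    by simp
qed

lemma emeasure_lborel_permute_coords:
  assumes "bij (e :: 'm::finite \<Rightarrow> 'k::finite)" "X \<in> sets borel"
  shows "emeasure lborel X = emeasure lborel ((\<lambda>x :: real^'k. \<chi> j. x $ e j) -` X)"
proof -
  have "(\<lambda>x :: real^'k. \<chi> j. x $ e j) \<in> borel_measurable borel"
    by (intro borel_measurable_continuous_onI continuous_intros)
  thus ?thesis
    using assms by (subst lborel_permute_coords[OF assms(1), symmetric], subst emeasure_distr) auto
qed

lemma emeasure_cone_parametrization: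
  fixes \<phi> :: "real^'n::finite \<Rightarrow> real^'m::finite"
  assumes card: "CARD('m) = CARD('n) + 1"
    and \<phi>: "local_parametrization (sphere 0 1) U \<phi>"
    and B: "B \<in> sets borel" "B \<subseteq> U"
  shows "ennreal (real (CARD('n) + 1)) * emeasure lborel (unit_cone (\<phi> ` B)) =
           (\<integral>\<^sup>+x\<in>B. ennreal (gram_density \<phi> x) \<partial>lborel)"
proof -
  let ?n = "CARD('n)"
  obtain e :: "'m \<Rightarrow> 'n aug" where e: "bij e"
    using finite_same_card_bij[of "UNIV :: 'm set" "UNIV :: 'n aug set"] card by (auto simp: CARD_aug)
  define D where "D x = frechet_derivative \<phi> (at x)" for x
  have U: "open U" and inj: "inj_on \<phi> U"
    and cont: "continuous_on U (\<lambda>x. matrix (frechet_derivative \<phi> (at x)))"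
    and opn: "openin (top_of_set (sphere 0 1)) (\<phi> ` U)"
    using \<phi> unfolding local_parametrization_def homeomorphism_def by (auto intro: inj_on_inverseI)
  have sph: "\<phi> x \<bullet> \<phi> x = 1" if "x \<in> U" for x
    using opn that openin_imp_subset[OF opn] by (auto simp: norm_eq_1)
  have D: "(\<phi> has_derivative D x) (at x)" if "x \<in> U" for x
    using \<phi> that unfolding local_parametrization_def D_def by (auto simp: frechet_derivative_works)
  \<comment> \<open>phi . phi is constantly 1 on the open set U, and its derivative is 2 phi . D
    h.\<close>
  have orth: "\<phi> x \<bullet> D x h = 0" if x: "x \<in> U" for x h
  proof -
    have "((\<lambda>y. \<phi> y \<bullet> \<phi> y) has_derivative (\<lambda>h. \<phi> x \<bullet> D x h + D x h \<bullet> \<phi> x)) (at x)"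
      by (intro derivative_intros D x)
    moreover have "((\<lambda>y. \<phi> y \<bullet> \<phi> y) has_derivative (\<lambda>h. 0)) (at x)"
      by (rule has_derivative_transform_within_open[OF has_derivative_const[of 1] U x]) (simp add: sph)
    ultimately have "(\<lambda>h. \<phi> x \<bullet> D x h + D x h \<bullet> \<phi> x) = (\<lambda>h. 0)"
      by (rule has_derivative_unique)
    from fun_cong[OF this, of h] show ?thesis by (simp add: inner_commute)
  qed
  \<comment> \<open>\<open>P\<close> renames coordinates along \<open>e\<close>, which makes
    \<open>F\<close> a map from \<open>real^'n aug\<close> to itself with a square Jacobian
    matrix.\<close>
  define P where "P w = (\<chi> k. w $ inv e k)" for w :: "real^'m"
  define F where "F y = P (y $ Apex *\<^sub>R \<phi> (aug_tail y))" for y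
  define F' where "F' y h = P (h $ Apex *\<^sub>R \<phi> (aug_tail y) + y $ Apex *\<^sub>R D (aug_tail y) (aug_tail h))" for y h
  \<comment> \<open>Excluding radius 0 keeps \<open>F\<close> injective: the norm recovers the
    radius, and then phi recovers the chart point.\<close>
  define S where "S = {y. y $ Apex \<in> {0<..1} \<and> aug_tail y \<in> B}"
  have P_inv: "(\<chi> j. P w $ e j) = w" for w
    using e by (simp add: P_def vec_eq_iff bij_is_inj)
  have inv_P: "P (\<chi> j. z $ e j) = z" for z
    using e by (simp add: P_def vec_eq_iff bij_is_surj surj_f_inv_f)
  have P_lin: "bounded_linear P"
    unfolding linear_conv_bounded_linear[symmetric] P_def by (rule linearI) (simp_all add: vec_eq_iff)
  have tail_meas: "(aug_tail :: real^'n aug \<Rightarrow> real^'n) \<in> borel_measurable borel"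
    by (intro borel_measurable_continuous_onI linear_continuous_on bounded_linear_aug_tail)
  have S: "S \<in> sets borel"
  proof -
    have "(\<lambda>y :: real^'n aug. y $ Apex) \<in> borel_measurable borel"
      by (intro borel_measurable_continuous_onI continuous_intros)
    from measurable_sets_borel[OF this, of "{0<..1}"] measurable_sets_borel[OF tail_meas B(1)]
    have "(\<lambda>y. y $ Apex) -` {0<..1} \<inter> aug_tail -` B \<in> sets borel"
      by auto
    thus ?thesis by (simp add: S_def vimage_def Collect_conj_eq Int_assoc)
  qed
  have image: "F ` S = (\<lambda>z. \<chi> j. z $ e j) -` unit_cone (\<phi> ` B)"
  proof (intro equalityI subsetI)
    fix z assume "z \<in> F ` S"
    then obtain y where y: "y \<in> S" "z = F y" by auto
    have "(\<chi> j. z $ e j) = y $ Apex *\<^sub>R \<phi> (aug_tail y)"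
      unfolding y(2) F_def by (rule P_inv)
    moreover have "norm (\<phi> (aug_tail y)) = 1"
      using y B(2) sph by (auto simp: S_def norm_eq_1)
    ultimately show "z \<in> (\<lambda>z. \<chi> j. z $ e j) -` unit_cone (\<phi> ` B)"
      using y by (auto simp: unit_cone_def S_def)
  next
    fix z assume z: "z \<in> (\<lambda>z. \<chi> j. z $ e j) -` unit_cone (\<phi> ` B)"
    define w where "w = (\<chi> j. z $ e j)"
    from z obtain x where x: "x \<in> B" "w /\<^sub>R norm w = \<phi> x" "w \<noteq> 0" "norm w \<le> 1"
      by (auto simp: unit_cone_def w_def)
    have "F (aug_join (norm w) x) = z"
      using x(3) by (simp add: F_def x(2)[symmetric] w_def inv_P)
    moreover have "aug_join (norm w) x \<in> S"
      using x by (simp add: S_def)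
    ultimately show "z \<in> F ` S" by blast
  qed
  have inj_F: "inj_on F S"
  proof (rule inj_onI)
    fix y z assume yz: "y \<in> S" "z \<in> S" "F y = F z"
    hence eq: "y $ Apex *\<^sub>R \<phi> (aug_tail y) = z $ Apex *\<^sub>R \<phi> (aug_tail z)"
      unfolding F_def by (metis P_inv)
    have nrm: "norm (\<phi> (aug_tail y)) = 1" "norm (\<phi> (aug_tail z)) = 1"
      using yz B(2) sph by (auto simp: S_def norm_eq_1)
    have Apex: "y $ Apex = z $ Apex"
      using arg_cong[OF eq, of norm] yz nrm by (simp add: S_def)
    hence "\<phi> (aug_tail y) = \<phi> (aug_tail z)"
      using eq yz by (simp add: S_def)
    hence "aug_tail y = aug_tail z"
      using inj yz B(2) by (auto simp: S_def inj_on_def)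
    thus "y = z"
      using Apex by (simp add: vec_eq_iff all_aug)
  qed
  have deriv: "(F has_derivative F' y) (at y within S)" if "y \<in> S" for y
  proof -
    have y: "aug_tail y \<in> U" using that B(2) by (auto simp: S_def)
    have "((\<lambda>y. \<phi> (aug_tail y)) has_derivative (\<lambda>h. D (aug_tail y) (aug_tail h))) (at y)"
      using has_derivative_compose[OF bounded_linear_imp_has_derivative[OF bounded_linear_aug_tail] D[OF y]]
      by simp
    moreover have "((\<lambda>y. y $ Apex) has_derivative (\<lambda>h. h $ Apex)) (at y)"
      by (intro bounded_linear_imp_has_derivative bounded_linear_vec_nth)
    ultimately have "((\<lambda>y. y $ Apex *\<^sub>R \<phi> (aug_tail y)) has_derivative
        (\<lambda>h. y $ Apex *\<^sub>R D (aug_tail y) (aug_tail h) + h $ Apex *\<^sub>R \<phi> (aug_tail y))) (at y)"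
      by (intro has_derivative_scaleR)
    from bounded_linear.has_derivative[OF P_lin this] show ?thesis
      unfolding F_def F'_def by (subst add.commute) (rule has_derivative_at_withinI)
  qed
  have jac: "\<bar>det (matrix (F' y))\<bar> = (y $ Apex) ^ ?n * gram_density \<phi> (aug_tail y)" if "y \<in> S" for y
  proof -
    have y: "aug_tail y \<in> U" "y $ Apex \<ge> 0" using that B(2) by (auto simp: S_def)
    show ?thesis
      unfolding F'_def P_def
      by (rule det_cone_map[OF e y(2) sph[OF y(1)] orth[OF y(1)] D_def has_derivative_linear[OF D[OF y(1)]]])
  qed
  \<comment> \<open>\<open>sqrt\<close> is negative at negative reals, so this needs an argument: at
    radius 1 the density is the absolute value of a Jacobian determinant.\<close>
  have gram_nonneg: "gram_density \<phi> x \<ge> 0" if "x \<in> U" for x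
  proof -
    have "1 ^ ?n * gram_density \<phi> x = 
            \<bar>det (matrix (\<lambda>h. \<chi> k. (h $ Apex *\<^sub>R \<phi> x + 1 *\<^sub>R D x (aug_tail h)) $ inv e k))\<bar>"
      by (rule det_cone_map[symmetric, OF e _ sph[OF that] orth[OF that] D_def has_derivative_linear[OF D[OF that]]]) simp
    also have "\<dots> \<ge> 0" by simp
    finally show ?thesis by simp
  qed
  \<comment> \<open>With the indicators inside, the integrand is a product of a function of the
    radius and a function of the chart point, on the whole space.\<close>
  let ?h = "\<lambda>r. ennreal (indicator {0<..1} r * r ^ ?n)"
  let ?g = "\<lambda>x. ennreal (indicator B x * gram_density \<phi> x)"
  have [measurable]: "?g \<in> borel_measurable borel"
    using borel_measurable_continuous_on_indicator[OF B(1)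
      continuous_on_subset[OF gram_density_continuous[OF cont] B(2)]]
    by simp
  note tail_meas [measurable]
  have [measurable]: "(\<lambda>y :: real^'n aug. y $ Apex) \<in> borel_measurable borel"
    by (intro borel_measurable_continuous_onI continuous_intros)
  have cone: "unit_cone (\<phi> ` B) \<in> sets borel"
    by (intro unit_cone_borel borel_image_parametrization[OF \<phi> _ B]) auto
  \<comment> \<open>The cone lies in the unit ball. Its finite volume lets the change of variables
    be read from the image to the domain, so integrability of the Jacobian is a conclusion.\<close>
  have fin: "emeasure lborel (unit_cone (\<phi> ` B)) < \<infinity>"
    by (rule emeasure_bounded_finite) (auto simp: bounded_iff unit_cone_def intro: exI[of _ 1])
  have FS_borel: "F ` S \<in> sets borel"
  proof -
    have "(\<lambda>z :: real^'n aug. \<chi> j. z $ e j) \<in> borel_measurable borel"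
      by (intro borel_measurable_continuous_onI continuous_intros)
    from measurable_sets_borel[OF this cone] show ?thesis
      by (simp only: image)
  qed
  have FS: "emeasure lborel (F ` S) = emeasure lborel (unit_cone (\<phi> ` B))"
    unfolding image using emeasure_lborel_permute_coords[OF e cone] by simp
  have "F ` S \<in> lmeasurable"
    using FS_borel FS fin by (intro fmeasurableI) auto
  hence "((\<lambda>y. \<bar>det (matrix (F' y))\<bar>) has_integral measure lebesgue (F ` S)) S"
    using has_measure_differentiable_image[of S F F' "measure lebesgue (F ` S)"] S deriv inj_F by auto
  hence "((\<lambda>y. (y $ Apex) ^ ?n * gram_density \<phi> (aug_tail y)) has_integral measure lebesgue (F ` S)) S"
    by (rule has_integral_eq[rotated]) (simp add: jac)
  hence I: "(\<integral>\<^sup>+y\<in>S. ennreal ((y $ Apex) ^ ?n * gram_density \<phi> (aug_tail y)) \<partial>lborel) = 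
      ennreal (measure lebesgue (F ` S))"
    using B(2)
    by (intro nn_integral_has_integral_lebesgue') (auto simp: S_def intro!: mult_nonneg_nonneg gram_nonneg)
  have "emeasure lborel (unit_cone (\<phi> ` B)) = ennreal (measure lebesgue (F ` S))"
    using fin FS_borel unfolding FS[symmetric] by (simp add: emeasure_eq_ennreal_measure)
  also have "\<dots> = (\<integral>\<^sup>+y. ?h (y $ Apex) * ?g (aug_tail y) \<partial>lborel)"
    unfolding I[symmetric]
    by (intro nn_integral_cong)
       (auto simp: S_def indicator_def ennreal_mult gram_nonneg subsetD[OF B(2)])
  also have "\<dots> = (\<integral>\<^sup>+r. \<integral>\<^sup>+x. ?h r * ?g x \<partial>lborel \<partial>lborel)"
    by (subst nn_integral_aug) simp_all
  also have "\<dots> = (\<integral>\<^sup>+r. ?h r \<partial>lborel) * (\<integral>\<^sup>+x. ?g x \<partial>lborel)"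
    by (simp add: nn_integral_cmult nn_integral_multc)
  also have "(\<integral>\<^sup>+r. ?h r \<partial>lborel) = ennreal (1 / (real ?n + 1))"
    unfolding nn_integral_power_01[symmetric] by (intro nn_integral_cong) (auto simp: indicator_def)
  also have "(\<integral>\<^sup>+x. ?g x \<partial>lborel) = (\<integral>\<^sup>+x\<in>B. ennreal (gram_density \<phi> x) \<partial>lborel)"
    by (intro nn_integral_cong) (auto simp: indicator_def)
  finally have "ennreal (real (?n + 1)) * emeasure lborel (unit_cone (\<phi> ` B)) =
    (ennreal (real (?n + 1)) * ennreal (1 / (real ?n + 1))) * (\<integral>\<^sup>+x\<in>B. ennreal (gram_density \<phi> x) \<partial>lborel)"
    by (simp only: mult.assoc)
  also have "ennreal (real (?n + 1)) * ennreal (1 / (real ?n + 1)) = 1"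
    by (subst ennreal_mult[symmetric]) auto
  finally show ?thesis by simp
qed

subsection \<open>Stereographic charts\<close>

text \<open>
  The sign \<open>s = \<plusminus>1\<close> selects the pole that is omitted; the coordinate \<open>e j = Apex\<close> is the polar axis.
\<close>

definition stereo :: "real \<Rightarrow> ('m \<Rightarrow> 'n aug) \<Rightarrow> real^'n::finite \<Rightarrow> real^'m::finite" where
  "stereo s e x = (\<chi> j. aug_join (s * (norm x ^ 2 - 1)) (2 *\<^sub>R x) $ e j / (norm x ^ 2 + 1))"

text \<open>On the sphere, the denominator vanishes only at the omitted pole.\<close>

definition stereo_inv :: "real \<Rightarrow> ('m \<Rightarrow> 'n aug) \<Rightarrow> real^'m::finite \<Rightarrow> real^'n::finite" where
  "stereo_inv s e y = (\<chi> i. y $ inv e (Coord i) / (1 - s * y $ inv e Apex))"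

lemma norm_sq_vec: "(norm (x :: real^'n::finite))\<^sup>2 = (\<Sum>i\<in>UNIV. (x $ i)\<^sup>2)"
  by (simp add: norm_vec_def L2_set_def sum_nonneg)

lemma sphere_coords:
  fixes y :: "real^'m::finite" and e :: "'m \<Rightarrow> 'n::finite aug"
  assumes "bij e"
  shows "(norm y)\<^sup>2 = (y $ inv e Apex)\<^sup>2 + (\<Sum>i\<in>UNIV. (y $ inv e (Coord i))\<^sup>2)"
proof -
  have "(norm y)\<^sup>2 = (\<Sum>k\<in>UNIV. (y $ inv e k)\<^sup>2)"
    unfolding norm_sq_vec
    using sum.reindex_bij_betw[OF bij_imp_bij_inv[OF assms], of "\<lambda>j. (y $ j)\<^sup>2"] by simp
  thus ?thesis by (simp add: sum_aug)
qed

lemma stereo_nth: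
  assumes "bij e"
  shows "stereo s e x $ inv e Apex = s * (norm x ^ 2 - 1) / (norm x ^ 2 + 1)"
    and "stereo s e x $ inv e (Coord i) = 2 * x $ i / (norm x ^ 2 + 1)"
  using assms by (simp_all add: stereo_def bij_is_surj surj_f_inv_f)

lemma stereo_denom: "(norm x)\<^sup>2 + 1 > 0" "(norm x)\<^sup>2 + 1 \<noteq> 0"
  by (simp_all add: add_nonneg_pos add_nonneg_eq_0_iff)

lemma stereo_1_minus:
  assumes "bij e" "s\<^sup>2 = 1"
  shows "1 - s * stereo s e x $ inv e Apex = 2 / (norm x ^ 2 + 1)"
proof -
  have "s * stereo s e x $ inv e Apex = s\<^sup>2 * (norm x ^ 2 - 1) / (norm x ^ 2 + 1)"
    by (simp add: stereo_nth[OF assms(1)] power2_eq_square)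
  thus ?thesis
    using stereo_denom[of x] assms(2) by (simp add: field_simps)
qed

lemma stereo_sphere:
  fixes e :: "'m::finite \<Rightarrow> 'n::finite aug"
  assumes "bij e" "s\<^sup>2 = 1"
  shows "norm (stereo s e x) = 1"
proof -
  have "(\<Sum>i\<in>UNIV. (2 * x $ i / (norm x ^ 2 + 1))\<^sup>2) = 4 * (norm x)\<^sup>2 / ((norm x)\<^sup>2 + 1)\<^sup>2"
    by (simp add: norm_sq_vec[of x] power_divide power_mult_distrib sum_divide_distrib sum_distrib_left)
  hence "(norm (stereo s e x))\<^sup>2 = ((norm x)\<^sup>2 - 1)\<^sup>2 / ((norm x)\<^sup>2 + 1)\<^sup>2 + 4 * (norm x)\<^sup>2 / ((norm x)\<^sup>2 + 1)\<^sup>2"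
    by (simp add: sphere_coords[OF assms(1)] stereo_nth[OF assms(1)] power_divide power_mult_distrib assms(2))
  \<comment> \<open>With t = |x|^2 this is (t - 1)^2 + 4t = (t + 1)^2.\<close>
  also have "\<dots> = 1"
    using stereo_denom(2)[of x] by (simp add: add_divide_distrib[symmetric]) (simp add: power2_eq_square algebra_simps)
  finally show ?thesis
    by (intro power2_eq_imp_eq[of _ 1]) auto
qed

lemma stereo_inv_stereo:
  assumes "bij e" "s\<^sup>2 = 1"
  shows "stereo_inv s e (stereo s e x) = x"
proof -
  have "2 * x $ i / ((norm x)\<^sup>2 + 1) / (2 / ((norm x)\<^sup>2 + 1)) = x $ i" for i
    using stereo_denom[of x] by (simp add: field_simps)
  thus ?thesis
    by (simp only: vec_eq_iff stereo_inv_def vec_lambda_beta stereo_1_minus[OF assms] stereo_nth(2)[OF assms(1)] simp_thms)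
qed

lemma stereo_stereo_inv:
  fixes y :: "real^'m::finite" and e :: "'m \<Rightarrow> 'n::finite aug"
  assumes "bij e" "s\<^sup>2 = 1" "norm y = 1" "s * y $ inv e Apex \<noteq> 1"
  shows "stereo s e (stereo_inv s e y) = y"
proof -
  \<comment> \<open>The height in the direction of the omitted pole. The preimage has squared norm
    (1 - a^2) / (1 - a)^2 = (1 + a) / (1 - a).\<close>
  define a where "a = s * y $ inv e Apex"
  have a: "a \<noteq> 1" using assms by (simp add: a_def)
  have ya: "y $ inv e Apex = s * a"
    using assms(2) by (simp add: a_def power2_eq_square mult.assoc[symmetric])
  have "(\<Sum>i\<in>UNIV. (y $ inv e (Coord i))\<^sup>2) = 1 - a\<^sup>2"
    using sphere_coords[OF assms(1), of y] assms(2,3) by (simp add: a_def power_mult_distrib)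
  hence nrm: "(norm (stereo_inv s e y))\<^sup>2 = (1 + a) / (1 - a)"
    using a unfolding norm_sq_vec stereo_inv_def a_def[symmetric]
    by (simp add: power_divide sum_divide_distrib[symmetric] frac_eq_eq) (simp add: power2_eq_square algebra_simps)
  have d: "(1 + a) / (1 - a) + 1 = 2 / (1 - a)" "(1 + a) / (1 - a) - 1 = 2 * a / (1 - a)"
    using a by (simp_all add: field_simps)
  have "stereo s e (stereo_inv s e y) $ inv e k = y $ inv e k" for k
    using a by (cases k) (simp_all add: stereo_nth[OF assms(1)] nrm d ya, simp add: stereo_inv_def a_def)
  hence "stereo s e (stereo_inv s e y) $ j = y $ j" for j
    using assms(1) by (metis bij_inv_eq_iff)
  thus ?thesis by (simp add: vec_eq_iff)
qed

lemma stereo_image: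
  fixes e :: "'m::finite \<Rightarrow> 'n::finite aug"
  assumes "bij e" "s\<^sup>2 = 1"
  shows "range (stereo s e) = sphere 0 1 \<inter> {y. s * y $ inv e Apex \<noteq> 1}"
proof (intro equalityI subsetI)
  fix y assume "y \<in> sphere 0 1 \<inter> {y. s * y $ inv e Apex \<noteq> 1}"
  hence "stereo s e (stereo_inv s e y) = y"
    by (intro stereo_stereo_inv assms) auto
  thus "y \<in> range (stereo s e)" by (metis rangeI)
next
  fix y assume "y \<in> range (stereo s e)"
  then obtain x where y: "y = stereo s e x" by auto
  show "y \<in> sphere 0 1 \<inter> {y. s * y $ inv e Apex \<noteq> 1}"
    using stereo_1_minus[OF assms, of x] stereo_denom[of x] stereo_sphere[OF assms] by (auto simp: y)
qed

lemma stereo_has_derivative: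
  fixes e :: "'m::finite \<Rightarrow> 'n::finite aug"
  shows "(stereo s e has_derivative (\<lambda>h. \<chi> j. 
     (aug_join (s * (2 * (x \<bullet> h))) (2 *\<^sub>R h) $ e j * (norm x ^ 2 + 1) - 
      aug_join (s * (norm x ^ 2 - 1)) (2 *\<^sub>R x) $ e j * (2 * (x \<bullet> h))) / (norm x ^ 2 + 1)\<^sup>2)) (at x)"
proof -
  have "((\<lambda>x. aug_join (s * (x \<bullet> x - 1)) (2 *\<^sub>R x) $ k / (x \<bullet> x + 1)) has_derivative 
     (\<lambda>h. (aug_join (s * (2 * (x \<bullet> h))) (2 *\<^sub>R h) $ k * (x \<bullet> x + 1) - 
      aug_join (s * (x \<bullet> x - 1)) (2 *\<^sub>R x) $ k * (2 * (x \<bullet> h))) / (x \<bullet> x + 1)\<^sup>2)) (at x)" for k :: "'n aug"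
    using stereo_denom(2)[of x, unfolded power2_norm_eq_inner]
    by (cases k)
       (auto intro!: derivative_eq_intros bounded_linear_imp_has_derivative simp: inner_commute field_simps power2_eq_square)
  thus ?thesis
    unfolding stereo_def power2_norm_eq_inner
    by (subst has_derivative_componentwise_within) (auto simp: Basis_vec_def inner_axis)
qed

lemma stereo_inv_differentiable:
  fixes e :: "'m::finite \<Rightarrow> 'n::finite aug"
  assumes "s * y $ inv e Apex \<noteq> 1"
  shows "stereo_inv s e differentiable (at y)"
proof -
  have "(\<lambda>y. y $ inv e (Coord i) / (1 - s * y $ inv e Apex)) differentiable (at y)" for i
    using assms by (intro derivative_intros bounded_linear_imp_differentiable bounded_linear_vec_nth) auto
  thus ?thesis
    unfolding stereo_inv_def
    by (subst differentiable_componentwise_within) (auto simp: Basis_vec_def inner_axis)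
qed

lemma local_parametrization_stereo:
  fixes e :: "'m::finite \<Rightarrow> 'n::finite aug"
  assumes e: "bij e" and s: "s\<^sup>2 = 1"
  shows "local_parametrization (sphere 0 1) UNIV (stereo s e)"
  unfolding local_parametrization_def
proof (intro conjI ballI exI)
  have diff: "stereo s e differentiable (at x)" for x
    using stereo_has_derivative differentiable_def by blast
  thus "stereo s e differentiable (at x)" for x .
  have "open {y. s * y $ inv e Apex \<noteq> 1}"
    by (intro open_Collect_neq continuous_intros)
  thus "openin (top_of_set (sphere 0 1)) (range (stereo s e))"
    unfolding stereo_image[OF e s] by (auto simp: openin_open)
  show "homeomorphism UNIV (range (stereo s e)) (stereo s e) (stereo_inv s e)"
  proof (rule homeomorphismI)
    show "continuous_on UNIV (stereo s e)"
      using diff by (intro differentiable_imp_continuous_on) (simp add: differentiable_on_def)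
    show "continuous_on (range (stereo s e)) (stereo_inv s e)"
      using stereo_inv_differentiable[of s _ e]
      by (intro differentiable_imp_continuous_on)
         (auto simp: differentiable_on_def stereo_image[OF e s] intro: differentiable_at_withinI)
  qed (auto simp: stereo_inv_stereo[OF e s])
  have fd: "frechet_derivative (stereo s e) (at x) = (\<lambda>h. \<chi> j. 
     (aug_join (s * (2 * (x \<bullet> h))) (2 *\<^sub>R h) $ e j * (norm x ^ 2 + 1) - 
      aug_join (s * (norm x ^ 2 - 1)) (2 *\<^sub>R x) $ e j * (2 * (x \<bullet> h))) / (norm x ^ 2 + 1)\<^sup>2)" for x
    by (rule frechet_derivative_at[symmetric, OF stereo_has_derivative])
  have "continuous_on UNIV (\<lambda>x. (aug_join (s * (2 * (x \<bullet> h))) (2 *\<^sub>R h) $ k * (norm x ^ 2 + 1) - 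
      aug_join (s * (norm x ^ 2 - 1)) (2 *\<^sub>R x) $ k * (2 * (x \<bullet> h))) / (norm x ^ 2 + 1)\<^sup>2)" 
    for k and h :: "real^'n"
    by (cases k) (auto intro!: continuous_intros simp: stereo_denom)
  thus "continuous_on UNIV (\<lambda>x. matrix (frechet_derivative (stereo s e) (at x)))"
    unfolding fd matrix_def vec_lambda_beta by (intro continuous_on_vec_lambda) assumption
  fix x :: "real^'n"
  have D: "(stereo s e has_derivative frechet_derivative (stereo s e) (at x)) (at x)"
    using diff by (simp add: frechet_derivative_works[symmetric])
  \<comment> \<open>\<open>stereo_inv\<close> is differentiable in the ambient space at this point,
    so the chain rule for the identity \<open>stereo_inv_stereo\<close> gives the derivative a left
    inverse. No rank has to be computed.\<close>
  have "stereo s e x \<in> sphere 0 1 \<inter> {y. s * y $ inv e Apex \<noteq> 1}"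
    using stereo_image[OF e s] by blast
  then obtain D' where D': "(stereo_inv s e has_derivative D') (at (stereo s e x))"
    using stereo_inv_differentiable[of s _ e] by (auto simp: differentiable_def)
  have "((\<lambda>x. stereo_inv s e (stereo s e x)) has_derivative 
           (\<lambda>h. D' (frechet_derivative (stereo s e) (at x) h))) (at x)"
    by (rule has_derivative_compose[OF D]) (use D' in simp)
  hence "(\<lambda>h. D' (frechet_derivative (stereo s e) (at x) h)) = (\<lambda>h. h)"
    unfolding stereo_inv_stereo[OF e s] using has_derivative_ident has_derivative_unique by blast
  thus "inj (frechet_derivative (stereo s e) (at x))"
    by (metis injI)
qed simp

subsection \<open>Existence and uniqueness of the volume measure\<close>

text \<open>The cone measure as a pushforward under radial projection, so that countable additivity
  comes for free.\<close>

definition sphere_measure :: "(real^'m::finite) measure" where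
  "sphere_measure = scale_measure (ennreal (real CARD('m)))
     (distr (restrict_space lborel (cball 0 1 - {0})) (restrict_space borel (sphere 0 1)) (\<lambda>y. y /\<^sub>R norm y))"

lemma sets_sphere_measure: "sets sphere_measure = sets (restrict_space borel (sphere 0 1))"
  by (simp add: sphere_measure_def)

lemma emeasure_sphere_measure:
  fixes A :: "(real^'m::finite) set"
  assumes "A \<in> sets borel" "A \<subseteq> sphere 0 1"
  shows "emeasure sphere_measure A = ennreal (real CARD('m)) * emeasure lborel (unit_cone A)"
proof -
  have "(\<lambda>y. y /\<^sub>R norm y) \<in> measurable (restrict_space lborel (cball 0 1 - {0})) (restrict_space borel (sphere (0 :: real^'m) 1))"
    by (intro measurable_restrict_space3) (auto simp: divide_simps)
  moreover have "A \<in> sets (restrict_space borel (sphere 0 1))"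
    using assms by (auto simp: sets_restrict_space_iff)
  moreover have "(\<lambda>y. y /\<^sub>R norm y) -` A \<inter> (cball 0 1 - {0}) = unit_cone A"
    by (auto simp: unit_cone_def)
  moreover have "unit_cone A \<subseteq> cball 0 1 - {0}"
    by (auto simp: unit_cone_def)
  ultimately show ?thesis
    unfolding sphere_measure_def
    by (simp add: emeasure_distr space_restrict_space emeasure_restrict_space)
qed

lemma emeasure_sphere_measure_parametrization:
  fixes \<phi> :: "real^'n::finite \<Rightarrow> real^'m::finite"
  assumes "CARD('m) = CARD('n) + 1"
    and \<phi>: "local_parametrization (sphere 0 1) U \<phi>"
    and B: "B \<in> sets borel" "B \<subseteq> U"
  shows "emeasure sphere_measure (\<phi> ` B) = (\<integral>\<^sup>+x\<in>B. ennreal (gram_density \<phi> x) \<partial>lborel)"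
proof -
  have "\<phi> ` B \<in> sets borel"
    by (rule borel_image_parametrization[OF \<phi> _ B]) simp
  moreover have "\<phi> ` B \<subseteq> sphere 0 1"
    using \<phi> B(2) openin_imp_subset unfolding local_parametrization_def by fastforce
  ultimately show ?thesis
    using emeasure_cone_parametrization[OF assms] assms(1) by (simp add: emeasure_sphere_measure)
qed

text \<open>The uniqueness half of the description. Charts with domain \<open>UNIV\<close> are
  enough, since the stereographic ones are of this kind.\<close>

lemma measure_on_sphere_eqI:
  fixes \<sigma> \<tau> :: "(real^'m::finite) measure"
  assumes card: "CARD('m) = CARD('n::finite) + 1"
    and sets: "sets \<sigma> = sets (restrict_space borel (sphere 0 1))"
      "sets \<tau> = sets (restrict_space borel (sphere 0 1))"
    and charts: "\<And>\<phi> B. local_parametrization (sphere 0 1) UNIV \<phi> \<Longrightarrow> B \<in> sets borel \<Longrightarrow>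
      emeasure \<sigma> (\<phi> ` B) = emeasure \<tau> ((\<phi> :: real^'n \<Rightarrow> real^'m) ` B)"
  shows "\<sigma> = \<tau>"
proof (rule measure_eqI)
  show "sets \<sigma> = sets \<tau>" using sets by simp
  fix A assume A: "A \<in> sets \<sigma>"
  have sets_iff: "X \<in> sets \<sigma> \<longleftrightarrow> X \<in> sets borel \<and> X \<subseteq> sphere 0 1" "X \<in> sets \<tau> \<longleftrightarrow> X \<in> sets borel \<and> X \<subseteq> sphere 0 1" for X
    using sets by (auto simp: sets_restrict_space_iff)
  obtain e :: "'m \<Rightarrow> 'n aug" where e: "bij e"
    using finite_same_card_bij[of "UNIV :: 'm set" "UNIV :: 'n aug set"] card by (auto simp: CARD_aug)
  have eq: "emeasure \<sigma> X = emeasure \<tau> X" if X: "X \<in> sets borel" "X \<subseteq> range (stereo s e)" and s: "s\<^sup>2 = 1" for X s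
  proof -
    note lp = local_parametrization_stereo[OF e s]
    have "stereo s e \<in> borel_measurable borel"
      using lp unfolding local_parametrization_def homeomorphism_def
      by (intro borel_measurable_continuous_onI) auto
    from measurable_sets_borel[OF this X(1)] charts[OF lp]
    have "emeasure \<sigma> (stereo s e ` (stereo s e -` X)) = emeasure \<tau> (stereo s e ` (stereo s e -` X))"
      by blast
    also have "stereo s e ` (stereo s e -` X) = X"
      using X(2) by auto
    finally show ?thesis .
  qed
  let ?V = "\<lambda>s. range (stereo s e)"
  have "?V 1 \<in> sets borel"
    by (rule borel_image_parametrization[OF local_parametrization_stereo[OF e]]) auto
  hence parts: "A \<inter> ?V 1 \<in> sets borel" "A - ?V 1 \<in> sets borel" "A \<subseteq> sphere 0 1"
    using A by (auto simp: sets_iff)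
  \<comment> \<open>Outside the first chart the polar coordinate is 1, whereas the second chart
    omits only the value -1.\<close>
  have "A - ?V 1 \<subseteq> ?V (-1)"
    using parts(3) by (auto simp: stereo_image[OF e])
  hence "emeasure \<sigma> (A - ?V 1) = emeasure \<tau> (A - ?V 1)"
    by (rule eq[OF parts(2), of "-1"]) auto
  moreover have "emeasure \<sigma> (A \<inter> ?V 1) = emeasure \<tau> (A \<inter> ?V 1)"
    by (rule eq[OF parts(1), of 1]) auto
  moreover have "emeasure M A = emeasure M (A \<inter> ?V 1) + emeasure M (A - ?V 1)" if "M \<in> {\<sigma>, \<tau>}" for M
    using that parts by (subst plus_emeasure) (auto simp: sets_iff Int_Diff_Un)
  ultimately show "emeasure \<sigma> A = emeasure \<tau> A" by simp
qed

lemma volume_measure_sphere: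
  assumes card: "CARD('m::finite) = CARD('n::finite) + 1"
  shows "volume_measure TYPE('n) (sphere (0 :: real^'m) 1) = sphere_measure"
  unfolding volume_measure_def
proof (rule the_equality, goal_cases)
  case 1
  show ?case
    using emeasure_sphere_measure_parametrization[OF card] by (auto simp: sets_sphere_measure)
next
  case (2 \<sigma>)
  show ?case
  proof (rule measure_on_sphere_eqI[OF card])
    fix \<phi> :: "real^'n \<Rightarrow> real^'m" and B :: "(real^'n) set"
    assume *: "local_parametrization (sphere 0 1) UNIV \<phi>" "B \<in> sets borel"
    thus "emeasure \<sigma> (\<phi> ` B) = emeasure sphere_measure (\<phi> ` B)"
      using 2 emeasure_sphere_measure_parametrization[OF card *] by auto
  qed (use 2 in \<open>auto simp: sets_sphere_measure\<close>)
qed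

text \<open>The cone over the whole sphere is the punctured unit ball. With m = n + 1, the mass is m
  pi^(m/2) / Gamma(m/2 + 1), and Gamma(m/2 + 1) = (m/2) Gamma(m/2) removes the factor m.\<close>

lemma measure_volume_sphere:
  assumes card: "CARD('m::finite) = CARD('n::finite) + 1"
  shows "measure (volume_measure TYPE('n) (sphere (0 :: real^'m) 1)) (sphere 0 1) =
           2 * pi powr ((real CARD('n) + 1) / 2) / Gamma ((real CARD('n) + 1) / 2)"
proof -
  let ?m = "real CARD('m)"
  have "unit_cone (sphere 0 1) = cball 0 1 - {0 :: real^'m}"
    by (auto simp: unit_cone_def divide_simps)
  hence "emeasure lborel (unit_cone (sphere (0 :: real^'m) 1)) = ennreal (unit_ball_vol ?m)"
    by (simp add: emeasure_Diff emeasure_cball)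
  hence "emeasure sphere_measure (sphere (0 :: real^'m) 1) = ennreal (?m * unit_ball_vol ?m)"
    by (simp add: emeasure_sphere_measure ennreal_mult)
  hence "measure sphere_measure (sphere (0 :: real^'m) 1) = ?m * unit_ball_vol ?m"
    by (simp add: measure_def)
  also have "\<dots> = 2 * pi powr (?m / 2) / Gamma (?m / 2)"
  proof -
    have "?m / 2 > 0" by simp
    hence G: "Gamma (?m / 2 + 1) = ?m / 2 * Gamma (?m / 2)"
      by (intro Gamma_plus1) (use nonpos_Ints_nonpos[of "?m / 2"] in linarith)
    show ?thesis unfolding unit_ball_vol_def G by simp
  qed
  finally show ?thesis
    unfolding volume_measure_sphere[OF card] using card by (simp add: add.commute)
qed

theorem theorem1:
  fixes n :: nat
  assumes "n > 0"
    and "CARD('n::finite) = n"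
    and "CARD('m::finite) = n + 1"
  shows "complex_of_real
           (measure (volume_measure TYPE('n) (sphere (0 :: real ^ 'm) 1)) (sphere 0 1)) =
         2 * (\<Prod>j<n. Z_fun (- of_nat j))"
proof -
  have "CARD('m) = CARD('n) + 1" using assms by simp
  from measure_volume_sphere[OF this] show ?thesis
    unfolding prod_Z_fun assms(2) by simp
qed

end
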